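(* Suppose $H=\infty$ and $\gamma<1$. Assume that for every $h\ge1$ the distribution $P_h$ of $(s_h,a_h)$ is absolutely continuous with respect to $\mu$, and let $w=\frac{d\nu}{d\mu}$. Let $\mathcal X\subset\Omega$ be a finite nonempty set of operators that are independent of the dataset $\mathcal D$. Let $H^*\ge n^{1/4}$ and $\hat X_{\text{RM-FP}}\in\operatorname{argmin}_{X\in\mathcal X}\mathrm{Regret}^*_{\mathcal D,\pi}(\bar Q^X_{H^*};\mathcal X)$. Then $\bar Q^{\hat X_{\text{RM-FP}}}_{H^*}$ is $(\mathcal X,\mathcal C_2)$-optimal, where $\mathcal C_2(X)=3\varphi_{L^2(\mu)}(\|\Delta X\|_2)$. Moreover, for $\delta\in(0,1)$, with probability $1-\delta$, $$\mathrm{Subopt}(\bar Q^{\hat X_{\text{RM-FP}}}_{H^*};\mathcal X,\mathcal C_2)=\mathcal O\left(C^2\|w\|_2\left(\frac{\ln(|\mathcal X|/\delta)}{n}\right)^{1/4}\right).$$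
   Context: All functions (and images of functions under operators) are assumed suitably measurable. $\mathcal O(\cdot)$ hides universal multiplicative constants in the limit $n\to\infty$, where $n$ is the data size. $\mathcal P(\cdot)$ denotes the set of probability distributions on a space. The state-action space $\mathcal S\times\mathcal A$ is a compact measurable space. A Markov decision process consists of an initial state distribution $S_1\in\mathcal P(\mathcal S)$, reward distributions $R(s,a)\in\mathcal P([0,1])$ and transition distributions $T(s,a)\in\mathcal P(\mathcal S)$. A policy is a map $s\mapsto\pi(s)\in\mathcal P(\mathcal A)$. The horizon is infinite, $\gamma\in[0,1)$, and $C=\sum_{h\ge1}\gamma^{h-1}=\frac1{1-\gamma}$. Trajectories: $s_1\sim S_1$, $a_h\sim\pi(s_h)$, $r_h\sim R(s_h,a_h)$, $s_{h+1}\sim T(s_h,a_h)$; $P_h$ is the distribution of $(s_h,a_h)$ and $\nu=(1-\gamma)\sum_{h\ge1}\gamma^{h-1}P_h$. $\mu\in\mathcal P(\mathcal S\times\mathcal A)$ has $\mathrm{supp}(\mu)=\mathcal S\times\mathcal A$, and $\|\cdot\|_p$ is the $L^p(\mu)$-norm (with value $+\infty$ outside $L^p(\mu)$; an upper bound involving an infinite norm is vacuous). The dataset $\mathcal D=\{(\tilde s_i,\tilde a_i,\tilde r_i,\tilde s_i')\}_{i=1}^n$ consists of i.i.d. tuples with $(\tilde s_i,\tilde a_i)\sim\mu$, $\tilde r_i\sim R(\tilde s_i,\tilde a_i)$, $\tilde s_i'\sim T(\tilde s_i,\tilde a_i)$; for each $i$ an action $\tilde a_i'\sim\pi(\tilde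 s_i')$ is also drawn. For $f:\mathcal S\times\mathcal A\to\mathbb R$ write $f(s,\pi(s))=\mathbb E_{a\sim\pi(s)}[f(s,a)]$. The Bellman operator is $(B_\pi f)(s,a)=\mathbb E[r+\gamma f(s',\pi(s'))]$ with $r\sim R(s,a)$, $s'\sim T(s,a)$. $Q^\pi(s,a)=\mathbb E[\sum_{h\ge1}\gamma^{h-1}r_h\mid s_1=s,a_1=a]$, $J(Q)=\mathbb E_{s_1\sim S_1}[Q(s_1,\pi(s_1))]$, and $\Delta J(Q)=J(Q)-J(Q^\pi)$. $\Omega$ is the set of all operators $X:[0,C]^{\mathcal S\times\mathcal A}\to[0,C]^{\mathcal S\times\mathcal A}$. For $X\in\Omega$: $Q^X_0=0$, $Q^X_h=XQ^X_{h-1}$, $\Delta X=X-B_\pi$, and $\|\Delta X\|_2=\sup_{f:\mathcal S\times\mathcal A\to[0,C]}\|Xf-B_\pi f\|_2$. For an integer $H^*\ge1$, $\bar Q^X_{H^*}$ is defined as follows: if there is $1\le h\le H^*$ with $Q^X_h=Q^X_{h-1}$, then $\bar Q^X_{H^*}=Q^X_h$ for the smallest such $h$; otherwise $\bar Q^X_{H^*}=\frac1{H^*}\sum_{h=1}^{H^*}Q^X_h$. Squared Bellman loss: $\mathcal L_{\mathcal D,\pi}(X;f)=\frac1n\sum_{i=1}^n\{\tilde r_i+\gamma f(\tilde s_i',\tilde a_i')-(Xf)(\tilde s_i,\tilde a_i)\}^2$. Fixed-point Bellman regret: $\mathrm{Regret}^*_{\mathcal D,\pi}(f;\mathcal X)=\mathcal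 L_{\mathcal D,\pi}(\mathrm{Id};f)-\min_{A\in\mathcal X}\mathcal L_{\mathcal D,\pi}(A;f)$, where $\mathrm{Id}$ is the identity operator. A link function is a nonnegative, nondecreasing, continuous, concave function $\varphi$ on $\mathbb R_{\ge0}$ with $\varphi(0)=0$. $\varphi_{L^2(\mu)}$ denotes a link function, not depending on the data, such that $\varphi_{L^2(\mu)}(y)\le C\|w\|_2\,y$ for all $y\ge0$ and $|\Delta J(Q)|\le\varphi_{L^2(\mu)}(\|Q-B_\pi Q\|_2)$ for all $Q:\mathcal S\times\mathcal A\to[0,C]$ (such a function exists). For $\mathcal C:\Omega\to\mathbb R$ and a random function $\hat Q:\mathcal S\times\mathcal A\to[0,C]$, put $\mathrm{Subopt}(\hat Q;\mathcal X,\mathcal C)=\max\{0,|\Delta J(\hat Q)|-\min_{X\in\mathcal X}\mathcal C(X)\}$. $\hat Q$ is $(\mathcal X,\mathcal C)$-optimal if $\mathrm{Subopt}(\hat Q;\mathcal X,\mathcal C)\to0$ in probability as $n\to\infty$.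
   Formalization: A universal O-constant fails for |X|=1 as δ→1; here, for each δ₀ in (0,1), one constant serves all δ when |X|≥2 and all δ≤δ₀ when |X|=1. The constant is stated for state, action and probability spaces lying in fixed but arbitrary ambient sets. *)

theory Defs
  imports "HOL-Probability.Probability"
begin

text \<open>
  State and action spaces are measurable spaces with arbitrary carriers. \<open>mdp_top\<close> is the topology
  of the state-action space; it enters only through compactness and the support of the sampling
  distribution.
\<close>

record ('s, 'a) mdp =
  mdp_S :: "'s measure"
  mdp_A :: "'a measure"
  mdp_top :: "('s \<times> 'a) topology"
  mdp_init :: "'s measure"
  mdp_R :: "'s \<times> 'a \<Rightarrow> real measure"
  mdp_T :: "'s \<times> 'a \<Rightarrow> 's measure"
  mdp_disc :: real

definition SA :: "('s, 'a) mdp \<Rightarrow> ('s \<times> 'a) measure" where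
  "SA m = mdp_S m \<Otimes>\<^sub>M mdp_A m"

definition unit_borel :: "real measure" where
  "unit_borel = restrict_space borel {0..1}"

definition is_mdp :: "('s, 'a) mdp \<Rightarrow> bool" where
  "is_mdp m \<longleftrightarrow>
     compact_space (mdp_top m) \<and> topspace (mdp_top m) = space (SA m) \<and>
     (\<forall>U. openin (mdp_top m) U \<longrightarrow> U \<in> sets (SA m)) \<and>
     mdp_init m \<in> space (prob_algebra (mdp_S m)) \<and>
     mdp_R m \<in> SA m \<rightarrow>\<^sub>M prob_algebra unit_borel \<and>
     mdp_T m \<in> SA m \<rightarrow>\<^sub>M prob_algebra (mdp_S m) \<and>
     0 \<le> mdp_disc m \<and> mdp_disc m < 1"

definition is_policy :: "('s, 'a) mdp \<Rightarrow> ('s \<Rightarrow> 'a measure) \<Rightarrow> bool" where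
  "is_policy m \<pi> \<longleftrightarrow> \<pi> \<in> mdp_S m \<rightarrow>\<^sub>M prob_algebra (mdp_A m)"

definition meas_support :: "'x topology \<Rightarrow> 'x measure \<Rightarrow> 'x set" where
  "meas_support X \<mu> = {x \<in> topspace X. \<forall>U. openin X U \<and> x \<in> U \<longrightarrow> emeasure \<mu> U > 0}"

definition is_sampling :: "('s, 'a) mdp \<Rightarrow> ('s \<times> 'a) measure \<Rightarrow> bool" where
  "is_sampling m \<mu> \<longleftrightarrow>
     \<mu> \<in> space (prob_algebra (SA m)) \<and> meas_support (mdp_top m) \<mu> = space (SA m)"

definition Cmax :: "('s, 'a) mdp \<Rightarrow> real" where
  "Cmax m = 1 / (1 - mdp_disc m)"


subsection \<open>Trajectories\<close>

text \<open>Law of \<open>(s, a)\<close> with \<open>s \<sim> \<sigma>\<close> and \<open>a \<sim> \<pi>(s)\<close>.\<close>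

definition sa_law :: "('s, 'a) mdp \<Rightarrow> ('s \<Rightarrow> 'a measure) \<Rightarrow> 's measure \<Rightarrow> ('s \<times> 'a) measure" where
  "sa_law m \<pi> \<sigma> = \<sigma> \<bind> (\<lambda>s. \<pi> s \<bind> (\<lambda>a. return (SA m) (s, a)))"

definition step_space :: "('s, 'a) mdp \<Rightarrow> (('s \<times> 'a) \<times> real) measure" where
  "step_space m = SA m \<Otimes>\<^sub>M unit_borel"

text \<open>Law of \<open>((s, a), r)\<close> with \<open>(s, a) \<sim> \<rho>\<close> and \<open>r \<sim> R(s, a)\<close>.\<close>

definition step_law :: "('s, 'a) mdp \<Rightarrow> ('s \<times> 'a) measure \<Rightarrow> (('s \<times> 'a) \<times> real) measure" where
  "step_law m \<rho> = \<rho> \<bind> (\<lambda>x. mdp_R m x \<bind> (\<lambda>r. return (step_space m) (x, r)))"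

text \<open>
  A trajectory is a sequence \<open>\<omega>\<close> with \<open>\<omega> k = ((s, a), r)\<close> the data of time \<open>h = k + 1\<close>. Its law,
  when \<open>(s\<^sub>1, a\<^sub>1)\<close> has law \<open>\<rho>\<close>, is the Ionescu-Tulcea measure of the kernels below.
\<close>

fun traj_kernel :: "('s, 'a) mdp \<Rightarrow> ('s \<Rightarrow> 'a measure) \<Rightarrow> ('s \<times> 'a) measure \<Rightarrow> nat \<Rightarrow>
    (nat \<Rightarrow> ('s \<times> 'a) \<times> real) \<Rightarrow> (('s \<times> 'a) \<times> real) measure" where
  "traj_kernel m \<pi> \<rho> 0 \<omega> = step_law m \<rho>"
| "traj_kernel m \<pi> \<rho> (Suc k) \<omega> = step_law m (sa_law m \<pi> (mdp_T m (fst (\<omega> k))))"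

definition traj :: "('s, 'a) mdp \<Rightarrow> ('s \<Rightarrow> 'a measure) \<Rightarrow> ('s \<times> 'a) measure \<Rightarrow>
    (nat \<Rightarrow> ('s \<times> 'a) \<times> real) measure" where
  "traj m \<pi> \<rho> = projective_family.lim UNIV
     (Ionescu_Tulcea.CI (traj_kernel m \<pi> \<rho>) (\<lambda>_. step_space m)) (\<lambda>_. step_space m)"

text \<open>\<open>P\<^sub>h\<close>, for \<open>h \<ge> 1\<close>.\<close>

definition visit_law :: "('s, 'a) mdp \<Rightarrow> ('s \<Rightarrow> 'a measure) \<Rightarrow> nat \<Rightarrow> ('s \<times> 'a) measure" where
  "visit_law m \<pi> h = distr (traj m \<pi> (sa_law m \<pi> (mdp_init m))) (SA m) (\<lambda>\<omega>. fst (\<omega> (h - 1)))"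

definition occupancy :: "('s, 'a) mdp \<Rightarrow> ('s \<Rightarrow> 'a measure) \<Rightarrow> ('s \<times> 'a) measure" where
  "occupancy m \<pi> = measure_of (space (SA m)) (sets (SA m))
     (\<lambda>E. \<Sum>k. ennreal ((1 - mdp_disc m) * mdp_disc m ^ k) * emeasure (visit_law m \<pi> (Suc k)) E)"

definition weight :: "('s, 'a) mdp \<Rightarrow> ('s \<Rightarrow> 'a measure) \<Rightarrow> ('s \<times> 'a) measure \<Rightarrow> 's \<times> 'a \<Rightarrow> real" where
  "weight m \<pi> \<mu> x = enn2real (RN_deriv \<mu> (occupancy m \<pi>) x)"

definition L2norm :: "'x measure \<Rightarrow> ('x \<Rightarrow> real) \<Rightarrow> ennreal" where
  "L2norm \<mu> f = (let I = \<integral>\<^sup>+ x. ennreal ((f x)\<^sup>2) \<partial>\<mu>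
                 in if I = \<infinity> then \<infinity> else ennreal (sqrt (enn2real I)))"


subsection \<open>Value functions and operators\<close>

text \<open>Functions on the state-action space are extensional, so that \<open>=\<close> is equality on the carrier.\<close>

definition Qfuns :: "('s, 'a) mdp \<Rightarrow> ('s \<times> 'a \<Rightarrow> real) set" where
  "Qfuns m = {f \<in> borel_measurable (SA m). f \<in> space (SA m) \<rightarrow>\<^sub>E {0..Cmax m}}"

definition Omega :: "('s, 'a) mdp \<Rightarrow> (('s \<times> 'a \<Rightarrow> real) \<Rightarrow> ('s \<times> 'a \<Rightarrow> real)) set" where
  "Omega m = Qfuns m \<rightarrow>\<^sub>E Qfuns m"

definition pol_eval :: "('s \<Rightarrow> 'a measure) \<Rightarrow> ('s \<times> 'a \<Rightarrow> real) \<Rightarrow> 's \<Rightarrow> real" where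
  "pol_eval \<pi> f s = (\<integral>a. f (s, a) \<partial>\<pi> s)"

definition Bellman :: "('s, 'a) mdp \<Rightarrow> ('s \<Rightarrow> 'a measure) \<Rightarrow>
    ('s \<times> 'a \<Rightarrow> real) \<Rightarrow> ('s \<times> 'a \<Rightarrow> real)" where
  "Bellman m \<pi> f = (\<lambda>x\<in>space (SA m).
     \<integral>r. (\<integral>s'. r + mdp_disc m * pol_eval \<pi> f s' \<partial>mdp_T m x) \<partial>mdp_R m x)"

definition Qpi :: "('s, 'a) mdp \<Rightarrow> ('s \<Rightarrow> 'a measure) \<Rightarrow> 's \<times> 'a \<Rightarrow> real" where
  "Qpi m \<pi> = (\<lambda>x\<in>space (SA m).
     \<integral>\<omega>. (\<Sum>k. mdp_disc m ^ k * snd (\<omega> k)) \<partial>traj m \<pi> (return (SA m) x))"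

definition Jval :: "('s, 'a) mdp \<Rightarrow> ('s \<Rightarrow> 'a measure) \<Rightarrow> ('s \<times> 'a \<Rightarrow> real) \<Rightarrow> real" where
  "Jval m \<pi> Q = (\<integral>s. pol_eval \<pi> Q s \<partial>mdp_init m)"

definition Delta_J :: "('s, 'a) mdp \<Rightarrow> ('s \<Rightarrow> 'a measure) \<Rightarrow> ('s \<times> 'a \<Rightarrow> real) \<Rightarrow> real" where
  "Delta_J m \<pi> Q = Jval m \<pi> Q - Jval m \<pi> (Qpi m \<pi>)"

definition op_err :: "('s, 'a) mdp \<Rightarrow> ('s \<Rightarrow> 'a measure) \<Rightarrow> ('s \<times> 'a) measure \<Rightarrow>
    (('s \<times> 'a \<Rightarrow> real) \<Rightarrow> ('s \<times> 'a \<Rightarrow> real)) \<Rightarrow> ennreal" where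
  "op_err m \<pi> \<mu> X = (SUP f\<in>Qfuns m. L2norm \<mu> (\<lambda>x. X f x - Bellman m \<pi> f x))"

primrec Qiter :: "('s, 'a) mdp \<Rightarrow> (('s \<times> 'a \<Rightarrow> real) \<Rightarrow> ('s \<times> 'a \<Rightarrow> real)) \<Rightarrow>
    nat \<Rightarrow> 's \<times> 'a \<Rightarrow> real" where
  "Qiter m X 0 = (\<lambda>x\<in>space (SA m). 0)"
| "Qiter m X (Suc h) = X (Qiter m X h)"

definition Qbar :: "('s, 'a) mdp \<Rightarrow> nat \<Rightarrow> (('s \<times> 'a \<Rightarrow> real) \<Rightarrow> ('s \<times> 'a \<Rightarrow> real)) \<Rightarrow>
    's \<times> 'a \<Rightarrow> real" where
  "Qbar m H X =
     (if \<exists>h\<in>{1..H}. Qiter m X h = Qiter m X (h - 1)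
      then Qiter m X (LEAST h. h \<in> {1..H} \<and> Qiter m X h = Qiter m X (h - 1))
      else (\<lambda>x\<in>space (SA m). (\<Sum>h=1..H. Qiter m X h x) / real H))"


subsection \<open>Data, loss and selection\<close>

text \<open>A sample is \<open>((s, a), r, s', a')\<close>, including the extra action \<open>a' \<sim> \<pi>(s')\<close>.\<close>

type_synonym ('s, 'a) sample = "('s \<times> 'a) \<times> real \<times> 's \<times> 'a"

definition sample_space :: "('s, 'a) mdp \<Rightarrow> ('s, 'a) sample measure" where
  "sample_space m = SA m \<Otimes>\<^sub>M unit_borel \<Otimes>\<^sub>M SA m"

definition sample_law :: "('s, 'a) mdp \<Rightarrow> ('s \<Rightarrow> 'a measure) \<Rightarrow> ('s \<times> 'a) measure \<Rightarrow>
    ('s, 'a) sample measure" where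
  "sample_law m \<pi> \<mu> = \<mu> \<bind> (\<lambda>x. mdp_R m x \<bind> (\<lambda>r. sa_law m \<pi> (mdp_T m x) \<bind>
     (\<lambda>y. return (sample_space m) (x, r, y))))"

definition is_dataset :: "('s, 'a) mdp \<Rightarrow> ('s \<Rightarrow> 'a measure) \<Rightarrow> ('s \<times> 'a) measure \<Rightarrow> nat \<Rightarrow>
    'w measure \<Rightarrow> (nat \<Rightarrow> 'w \<Rightarrow> ('s, 'a) sample) \<Rightarrow> bool" where
  "is_dataset m \<pi> \<mu> n M D \<longleftrightarrow>
     prob_space M \<and>
     prob_space.indep_vars M (\<lambda>_. sample_space m) D {..<n} \<and>
     (\<forall>i<n. distr M (sample_space m) (D i) = sample_law m \<pi> \<mu>)"

definition sq_loss :: "real \<Rightarrow> nat \<Rightarrow> (nat \<Rightarrow> ('s, 'a) sample) \<Rightarrow>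
    (('s \<times> 'a \<Rightarrow> real) \<Rightarrow> ('s \<times> 'a \<Rightarrow> real)) \<Rightarrow> ('s \<times> 'a \<Rightarrow> real) \<Rightarrow> real" where
  "sq_loss \<gamma> n d X f =
     (\<Sum>i<n. case d i of (x, r, y) \<Rightarrow> (r + \<gamma> * f y - X f x)\<^sup>2) / real n"

definition fp_regret :: "real \<Rightarrow> nat \<Rightarrow> (nat \<Rightarrow> ('s, 'a) sample) \<Rightarrow> ('s \<times> 'a \<Rightarrow> real) \<Rightarrow>
    (('s \<times> 'a \<Rightarrow> real) \<Rightarrow> ('s \<times> 'a \<Rightarrow> real)) set \<Rightarrow> real" where
  "fp_regret \<gamma> n d f XX = sq_loss \<gamma> n d id f - (MIN A\<in>XX. sq_loss \<gamma> n d A f)"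

definition is_RM_FP :: "('s, 'a) mdp \<Rightarrow> nat \<Rightarrow> 'w measure \<Rightarrow> (nat \<Rightarrow> 'w \<Rightarrow> ('s, 'a) sample) \<Rightarrow>
    (('s \<times> 'a \<Rightarrow> real) \<Rightarrow> ('s \<times> 'a \<Rightarrow> real)) set \<Rightarrow> nat \<Rightarrow>
    ('w \<Rightarrow> ('s \<times> 'a \<Rightarrow> real) \<Rightarrow> ('s \<times> 'a \<Rightarrow> real)) \<Rightarrow> bool" where
  "is_RM_FP m n M D XX H Xhat \<longleftrightarrow>
     Xhat \<in> M \<rightarrow>\<^sub>M count_space XX \<and>
     (\<forall>\<omega>\<in>space M. is_arg_min
        (\<lambda>X. fp_regret (mdp_disc m) n (\<lambda>i. D i \<omega>) (Qbar m H X) XX) (\<lambda>X. X \<in> XX) (Xhat \<omega>))"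


subsection \<open>Link functions and suboptimality\<close>

definition is_link :: "(real \<Rightarrow> real) \<Rightarrow> bool" where
  "is_link \<phi> \<longleftrightarrow> (\<forall>y\<ge>0. \<phi> y \<ge> 0) \<and> mono_on {0..} \<phi> \<and> continuous_on {0..} \<phi> \<and>
     concave_on {0..} \<phi> \<and> \<phi> 0 = 0"

text \<open>
  The first inequality is read in the extended reals: it is vacuous for \<open>y > 0\<close> if the weight is
  not square-integrable. The norms inside \<open>\<phi>\<close> are those of bounded functions, hence finite.
\<close>

definition is_L2_link :: "('s, 'a) mdp \<Rightarrow> ('s \<Rightarrow> 'a measure) \<Rightarrow> ('s \<times> 'a) measure \<Rightarrow>
    (real \<Rightarrow> real) \<Rightarrow> bool" where
  "is_L2_link m \<pi> \<mu> \<phi> \<longleftrightarrow> is_link \<phi> \<and>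
     (\<forall>y\<ge>0. ennreal (\<phi> y) \<le> ennreal (Cmax m) * L2norm \<mu> (weight m \<pi> \<mu>) * ennreal y) \<and>
     (\<forall>Q\<in>Qfuns m.
        \<bar>Delta_J m \<pi> Q\<bar> \<le> \<phi> (enn2real (L2norm \<mu> (\<lambda>x. Q x - Bellman m \<pi> Q x))))"

definition C2 :: "('s, 'a) mdp \<Rightarrow> ('s \<Rightarrow> 'a measure) \<Rightarrow> ('s \<times> 'a) measure \<Rightarrow> (real \<Rightarrow> real) \<Rightarrow>
    (('s \<times> 'a \<Rightarrow> real) \<Rightarrow> ('s \<times> 'a \<Rightarrow> real)) \<Rightarrow> real" where
  "C2 m \<pi> \<mu> \<phi> X = 3 * \<phi> (enn2real (op_err m \<pi> \<mu> X))"

definition subopt :: "('s, 'a) mdp \<Rightarrow> ('s \<Rightarrow> 'a measure) \<Rightarrow>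
    (('s \<times> 'a \<Rightarrow> real) \<Rightarrow> ('s \<times> 'a \<Rightarrow> real)) set \<Rightarrow>
    ((('s \<times> 'a \<Rightarrow> real) \<Rightarrow> ('s \<times> 'a \<Rightarrow> real)) \<Rightarrow> real) \<Rightarrow> ('s \<times> 'a \<Rightarrow> real) \<Rightarrow> real" where
  "subopt m \<pi> XX CC Q = max 0 (\<bar>Delta_J m \<pi> Q\<bar> - (MIN X\<in>XX. CC X))"

text \<open>Convergence of \<open>subopt\<close> to \<open>0\<close> in probability; \<open>M n\<close> carries the dataset of size \<open>n\<close>.\<close>

definition is_optimal :: "('s, 'a) mdp \<Rightarrow> ('s \<Rightarrow> 'a measure) \<Rightarrow>
    (('s \<times> 'a \<Rightarrow> real) \<Rightarrow> ('s \<times> 'a \<Rightarrow> real)) set \<Rightarrow>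
    ((('s \<times> 'a \<Rightarrow> real) \<Rightarrow> ('s \<times> 'a \<Rightarrow> real)) \<Rightarrow> real) \<Rightarrow>
    (nat \<Rightarrow> 'w measure) \<Rightarrow> (nat \<Rightarrow> 'w \<Rightarrow> 's \<times> 'a \<Rightarrow> real) \<Rightarrow> bool" where
  "is_optimal m \<pi> XX CC M Qhat \<longleftrightarrow>
     (\<forall>\<epsilon>>0. (\<lambda>n. measure (M n) {\<omega> \<in> space (M n). subopt m \<pi> XX CC (Qhat n \<omega>) > \<epsilon>})
        \<longlonglongrightarrow> 0)"

end

theory Submission
  imports Defs
begin

text \<open>
  The expected loss of an operator \<open>A\<close> at \<open>f\<close> is \<open>\<parallel>A f - B f\<parallel>\<^sup>2\<close> plus a noise term that does not depend
  on \<open>A\<close>. Hence, once all empirical losses are within \<open>\<epsilon>\<close> of their means (Hoeffding and a union bound),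
  comparing the regret of the selected value function \<open>f\<close> with that of \<open>g\<close>, the value function of a
  best operator \<open>X\<close>, gives \<open>\<parallel>f - B f\<parallel>\<^sup>2 \<le> \<parallel>g - B g\<parallel>\<^sup>2 + \<parallel>\<Delta>X\<parallel>\<^sup>2 + 4\<epsilon>\<close>. If \<open>g\<close> is a fixed point of \<open>X\<close>, then
  \<open>\<parallel>g - B g\<parallel> \<le> \<parallel>\<Delta>X\<parallel>\<close>. Otherwise \<open>g\<close> is an average of iterates; since \<open>B\<close> is affine, \<open>g - B g\<close> is the
  average of the errors \<open>X Q - B Q\<close> along the iteration plus a telescoping remainder of size at most
  \<open>C / H\<close>. So \<open>\<parallel>f - B f\<parallel> \<le> 2 \<parallel>\<Delta>X\<parallel> + C / H + 2 \<surd>\<epsilon>\<close>, and the link function, being concave with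
  \<open>\<phi> 0 = 0\<close>, is subadditive.
\<close>

section \<open>Integration against probability kernels\<close>

text \<open>Boundedness of \<open>f\<close> and total mass at most 1 of the kernels give the
  integrability behind this Fubini rule, so later uses only have to supply a bound.\<close>

lemma integral_bind_prob_algebra:
  fixes f :: "'b \<Rightarrow> real"
  assumes M: "M \<in> space (prob_algebra A)" and K: "K \<in> A \<rightarrow>\<^sub>M prob_algebra B"
    and f: "f \<in> borel_measurable B" and bd: "\<forall>y\<in>space B. \<bar>f y\<bar> \<le> c"
  shows "(\<integral>y. f y \<partial>(M \<bind> K)) = (\<integral>x. (\<integral>y. f y \<partial>K x) \<partial>M)"
proof -
  have sM: "sets M = sets A" "prob_space M"
    using M by (auto simp: space_prob_algebra)
  interpret prob_space M by fact
  have K': "K \<in> M \<rightarrow>\<^sub>M subprob_algebra B"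
    using measurable_prob_algebraD[OF K] by (simp cong: measurable_cong_sets add: sM)
  have "AE x in M. emeasure (K x) (space (K x)) \<le> ennreal 1"
    by (intro AE_I2) (simp add: subprob_space.emeasure_space_le_1 subprob_space_kernel[OF K'])
  then show ?thesis
    using integral_bind[OF f _ K' finite_measure_axioms] bd by blast
qed

lemma integral_kernel_measurable:
  fixes f :: "'b \<Rightarrow> real"
  assumes K: "K \<in> A \<rightarrow>\<^sub>M prob_algebra B" and f: "f \<in> borel_measurable B"
  shows "(\<lambda>x. \<integral>y. f y \<partial>K x) \<in> borel_measurable A"
  using measurable_compose[OF measurable_prob_algebraD[OF K] integral_measurable_subprob_algebra[OF f]] .

lemma restrict_borel_measurable:
  "f \<in> borel_measurable M \<Longrightarrow> restrict f (space M) \<in> borel_measurable M"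
  by (subst measurable_cong[where g=f]) auto

section \<open>The law of one sample\<close>

locale offline_mdp =
  fixes m :: "('s, 'a) mdp" and \<pi> :: "'s \<Rightarrow> 'a measure" and \<mu> :: "('s \<times> 'a) measure"
  assumes mdp: "is_mdp m" and policy: "is_policy m \<pi>" and sampling: "is_sampling m \<mu>"
begin

lemma kernels [measurable]:
  "mdp_R m \<in> SA m \<rightarrow>\<^sub>M prob_algebra unit_borel"
  "mdp_T m \<in> SA m \<rightarrow>\<^sub>M prob_algebra (mdp_S m)"
  "\<pi> \<in> mdp_S m \<rightarrow>\<^sub>M prob_algebra (mdp_A m)"
  using mdp policy by (auto simp: is_mdp_def is_policy_def)

lemma disc: "0 \<le> mdp_disc m" "mdp_disc m < 1"
  using mdp by (auto simp: is_mdp_def)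

lemma Cmax_ge_1: "1 \<le> Cmax m"
  using disc by (simp add: Cmax_def)

lemma one_plus_disc_Cmax: "1 + mdp_disc m * Cmax m = Cmax m"
  using disc by (simp add: Cmax_def field_simps)

lemma prob_mu: "prob_space \<mu>" and sets_mu [measurable_cong]: "sets \<mu> = sets (SA m)"
  using sampling by (auto simp: is_sampling_def space_prob_algebra)

lemma space_mu: "space \<mu> = space (SA m)"
  by (rule sets_eq_imp_space_eq[OF sets_mu])

lemma mu_in: "\<mu> \<in> space (prob_algebra (SA m))"
  using sampling by (simp add: is_sampling_def)

text \<open>The conditional law of a sample given its state-action pair. Splitting off the draw from
  \<open>\<mu>\<close> turns conditional expectations into inner integrals.\<close>

definition sample_kernel :: "'s \<times> 'a \<Rightarrow> ('s, 'a) sample measure" where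
  "sample_kernel x = mdp_R m x \<bind> (\<lambda>r. sa_law m \<pi> (mdp_T m x) \<bind>
     (\<lambda>y. return (sample_space m) (x, r, y)))"

lemma sa_law_kernel [measurable]:
  "(\<lambda>\<sigma>. sa_law m \<pi> \<sigma>) \<in> prob_algebra (mdp_S m) \<rightarrow>\<^sub>M prob_algebra (SA m)"
  unfolding sa_law_def SA_def by measurable

lemma sample_kernel_measurable [measurable]:
  "sample_kernel \<in> SA m \<rightarrow>\<^sub>M prob_algebra (sample_space m)"
  unfolding sample_kernel_def[abs_def] sample_space_def by measurable

lemma sample_law_eq: "sample_law m \<pi> \<mu> = \<mu> \<bind> sample_kernel"
  by (simp add: sample_law_def sample_kernel_def[abs_def])

text \<open>Unfolds the nested binds one at a time. The pair \<open>x\<close> is kept fixed while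
  reward, next state and next action are averaged; this is what links samples to the iterated
  integrals in \<open>Bellman\<close>.\<close>

lemma integral_sample_kernel:
  fixes h :: "('s, 'a) sample \<Rightarrow> real"
  assumes h [measurable]: "h \<in> borel_measurable (sample_space m)"
    and bd: "\<forall>z\<in>space (sample_space m). \<bar>h z\<bar> \<le> c" and x: "x \<in> space (SA m)"
  shows "(\<integral>z. h z \<partial>sample_kernel x) =
    (\<integral>r. (\<integral>s'. (\<integral>a'. h (x, r, (s', a')) \<partial>\<pi> s') \<partial>mdp_T m x) \<partial>mdp_R m x)"
proof -
  have R: "mdp_R m x \<in> space (prob_algebra unit_borel)"
    and T: "mdp_T m x \<in> space (prob_algebra (mdp_S m))"
    using x by (auto intro: measurable_space[OF kernels(1)] measurable_space[OF kernels(2)])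
  have sa: "sa_law m \<pi> (mdp_T m x) \<in> space (prob_algebra (SA m))"
    by (rule measurable_space[OF sa_law_kernel T])
  have h' [measurable]: "h \<in> borel_measurable (SA m \<Otimes>\<^sub>M unit_borel \<Otimes>\<^sub>M SA m)"
    using h by (simp add: sample_space_def)
  have hx: "(\<lambda>y. h (x, r, y)) \<in> borel_measurable (SA m)" if "r \<in> space unit_borel" for r
    using that x by measurable
  have bdx: "\<forall>y\<in>space (SA m). \<bar>h (x, r, y)\<bar> \<le> c" if "r \<in> space unit_borel" for r
    using that x bd by (simp add: sample_space_def space_pair_measure)
  have 1: "(\<integral>z. h z \<partial>sample_kernel x) =
      (\<integral>r. (\<integral>z. h z \<partial>(sa_law m \<pi> (mdp_T m x) \<bind> (\<lambda>y. return (sample_space m) (x, r, y)))) \<partial>mdp_R m x)"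
    unfolding sample_kernel_def
  proof (rule integral_bind_prob_algebra[OF R _ h bd])
    show "(\<lambda>r. sa_law m \<pi> (mdp_T m x) \<bind> (\<lambda>y. return (sample_space m) (x, r, y)))
      \<in> unit_borel \<rightarrow>\<^sub>M prob_algebra (sample_space m)"
      using x sa unfolding sample_space_def by measurable
  qed
  have 2: "(\<integral>z. h z \<partial>(sa_law m \<pi> (mdp_T m x) \<bind> (\<lambda>y. return (sample_space m) (x, r, y)))) =
      (\<integral>s'. (\<integral>a'. h (x, r, (s', a')) \<partial>\<pi> s') \<partial>mdp_T m x)" if r: "r \<in> space unit_borel" for r
  proof -
    have "(\<integral>z. h z \<partial>(sa_law m \<pi> (mdp_T m x) \<bind> (\<lambda>y. return (sample_space m) (x, r, y)))) =
      (\<integral>y. (\<integral>z. h z \<partial>return (sample_space m) (x, r, y)) \<partial>sa_law m \<pi> (mdp_T m x))"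
      by (rule integral_bind_prob_algebra[OF sa _ h bd])
        (use x r in \<open>unfold sample_space_def; measurable\<close>)
    also have "\<dots> = (\<integral>y. h (x, r, y) \<partial>sa_law m \<pi> (mdp_T m x))"
      using sa sets_eq_imp_space_eq[of "sa_law m \<pi> (mdp_T m x)" "SA m"] x r
      by (intro Bochner_Integration.integral_cong integral_return h)
        (auto simp: space_prob_algebra sample_space_def space_pair_measure)
    also have "\<dots> = (\<integral>s'. (\<integral>y. h (x, r, y) \<partial>(\<pi> s' \<bind> (\<lambda>a. return (SA m) (s', a)))) \<partial>mdp_T m x)"
      unfolding sa_law_def
      by (rule integral_bind_prob_algebra[OF T _ hx[OF r] bdx[OF r]])
        (unfold SA_def, measurable)
    also have "\<dots> = (\<integral>s'. (\<integral>a'. h (x, r, (s', a')) \<partial>\<pi> s') \<partial>mdp_T m x)"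
    proof (rule Bochner_Integration.integral_cong[OF refl])
      fix s' assume "s' \<in> space (mdp_T m x)"
      then have s: "s' \<in> space (mdp_S m)"
        using T sets_eq_imp_space_eq[of "mdp_T m x" "mdp_S m"] by (auto simp: space_prob_algebra)
      have p: "\<pi> s' \<in> space (prob_algebra (mdp_A m))"
        by (rule measurable_space[OF kernels(3) s])
      have "(\<integral>y. h (x, r, y) \<partial>(\<pi> s' \<bind> (\<lambda>a. return (SA m) (s', a)))) =
          (\<integral>a. (\<integral>y. h (x, r, y) \<partial>return (SA m) (s', a)) \<partial>\<pi> s')"
        by (rule integral_bind_prob_algebra[OF p _ hx[OF r] bdx[OF r]])
          (use s in \<open>unfold SA_def, measurable\<close>)
      also have "\<dots> = (\<integral>a. h (x, r, (s', a)) \<partial>\<pi> s')"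
        using p sets_eq_imp_space_eq[of "\<pi> s'" "mdp_A m"] s
        by (intro Bochner_Integration.integral_cong integral_return hx r)
          (auto simp: space_prob_algebra SA_def space_pair_measure)
      finally show "(\<integral>y. h (x, r, y) \<partial>(\<pi> s' \<bind> (\<lambda>a. return (SA m) (s', a)))) =
          (\<integral>a. h (x, r, (s', a)) \<partial>\<pi> s')" .
    qed
    finally show ?thesis .
  qed
  show ?thesis
    unfolding 1 using R sets_eq_imp_space_eq[of "mdp_R m x" unit_borel]
    by (intro Bochner_Integration.integral_cong 2) (auto simp: space_prob_algebra)
qed

lemma sample_kernel_prob:
  assumes "x \<in> space (SA m)"
  shows "prob_space (sample_kernel x)" and "sets (sample_kernel x) = sets (sample_space m)"
    and "space (sample_kernel x) = space (sample_space m)"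
  using measurable_space[OF sample_kernel_measurable assms] sets_eq_imp_space_eq
  by (auto simp: space_prob_algebra)

lemma sample_space_cases:
  assumes "z \<in> space (sample_space m)"
  obtains x r y where "z = (x, r, y)" "x \<in> space (SA m)" "0 \<le> r" "r \<le> 1" "y \<in> space (SA m)"
  using assms
  by (cases z) (auto simp: sample_space_def space_pair_measure unit_borel_def space_restrict_space)

section \<open>Bounded value functions, regression targets and the Bellman operator\<close>

lemma Qfuns_measurable: "f \<in> Qfuns m \<Longrightarrow> f \<in> borel_measurable (SA m)"
  by (simp add: Qfuns_def)

lemma Qfuns_bounds:
  assumes "f \<in> Qfuns m" "x \<in> space (SA m)"
  shows "0 \<le> f x" "f x \<le> Cmax m"
  using assms by (auto simp: Qfuns_def PiE_iff)

lemma QfunsI: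
  assumes "f \<in> borel_measurable (SA m)" "\<And>x. x \<in> space (SA m) \<Longrightarrow> 0 \<le> f x"
    "\<And>x. x \<in> space (SA m) \<Longrightarrow> f x \<le> Cmax m" "f \<in> extensional (space (SA m))"
  shows "f \<in> Qfuns m"
  using assms by (auto simp: Qfuns_def PiE_iff)

text \<open>The one-sample estimate of the Bellman image of \<open>f\<close>, to be used as the
  response in a least-squares regression on the pair.\<close>

definition target :: "('s \<times> 'a \<Rightarrow> real) \<Rightarrow> ('s, 'a) sample \<Rightarrow> real" where
  "target f z = fst (snd z) + mdp_disc m * f (snd (snd z))"

lemma target_measurable:
  assumes [measurable]: "f \<in> borel_measurable (SA m)"
  shows "target f \<in> borel_measurable (sample_space m)"
proof -
  have [measurable]: "(\<lambda>r. r) \<in> unit_borel \<rightarrow>\<^sub>M borel"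
    unfolding unit_borel_def by (rule measurable_restrict_space1) simp
  have "(\<lambda>z. fst (snd z) :: real) \<in> borel_measurable (sample_space m)"
    unfolding sample_space_def by (rule measurable_compose[where g="\<lambda>r. r"]) measurable
  moreover have "(\<lambda>z. f (snd (snd z))) \<in> borel_measurable (sample_space m)"
    unfolding sample_space_def by measurable
  ultimately show ?thesis unfolding target_def[abs_def] by measurable
qed

text \<open>The range [0, C] is preserved because C = 1 + \<gamma> C and rewards lie in
  [0, 1].\<close>

lemma target_bounds:
  assumes f: "f \<in> Qfuns m" and z: "z \<in> space (sample_space m)"
  shows "0 \<le> target f z" "target f z \<le> Cmax m"
proof -
  obtain x r y where *: "z = (x, r, y)" "0 \<le> r" "r \<le> 1" "y \<in> space (SA m)"
    using z by (rule sample_space_cases)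
  show "0 \<le> target f z" using * disc Qfuns_bounds[OF f, of y] by (simp add: target_def)
  have "r + mdp_disc m * f y \<le> 1 + mdp_disc m * Cmax m"
    using * disc Qfuns_bounds[OF f, of y] by (intro add_mono mult_left_mono) auto
  then show "target f z \<le> Cmax m" using * by (simp add: target_def one_plus_disc_Cmax)
qed

lemma integrable_kernel:
  fixes h :: "('s, 'a) sample \<Rightarrow> real"
  assumes x: "x \<in> space (SA m)" and h: "h \<in> borel_measurable (sample_space m)"
    and bd: "\<forall>z\<in>space (sample_space m). \<bar>h z\<bar> \<le> c"
  shows "integrable (sample_kernel x) h"
proof -
  interpret prob_space "sample_kernel x" by (rule sample_kernel_prob[OF x])
  show ?thesis
    using h bd sample_kernel_prob[OF x]
    by (intro integrable_const_bound[of _ c] AE_I2) (auto cong: measurable_cong_sets)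
qed

lemma target_integrable:
  assumes "f \<in> Qfuns m" "x \<in> space (SA m)"
  shows "integrable (sample_kernel x) (target f)"
  using assms target_bounds[of f]
  by (intro integrable_kernel[where c="Cmax m"] target_measurable Qfuns_measurable) auto

text \<open>Makes the Bellman image the regression function of the target. By linearity, the average
  over the extra action \<open>a'\<close> becomes \<open>pol_eval\<close>.\<close>

lemma Bellman_eq:
  assumes f: "f \<in> Qfuns m" and x: "x \<in> space (SA m)"
  shows "Bellman m \<pi> f x = (\<integral>z. target f z \<partial>sample_kernel x)"
proof -
  have T: "mdp_T m x \<in> space (prob_algebra (mdp_S m))"
    using x by (rule measurable_space[OF kernels(2)])
  have "(\<integral>z. target f z \<partial>sample_kernel x) =
    (\<integral>r. (\<integral>s'. (\<integral>a'. r + mdp_disc m * f (s', a') \<partial>\<pi> s') \<partial>mdp_T m x) \<partial>mdp_R m x)"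
    using integral_sample_kernel[OF target_measurable[OF Qfuns_measurable[OF f]] _ x, of "Cmax m"]
      target_bounds[OF f]
    by (simp add: target_def)
  also have "\<dots> = (\<integral>r. (\<integral>s'. r + mdp_disc m * pol_eval \<pi> f s' \<partial>mdp_T m x) \<partial>mdp_R m x)"
  proof (intro Bochner_Integration.integral_cong refl)
    fix r s' assume "s' \<in> space (mdp_T m x)"
    then have s: "s' \<in> space (mdp_S m)"
      using T sets_eq_imp_space_eq[of "mdp_T m x" "mdp_S m"] by (auto simp: space_prob_algebra)
    have "\<pi> s' \<in> space (prob_algebra (mdp_A m))"
      by (rule measurable_space[OF kernels(3) s])
    then have p: "prob_space (\<pi> s')" and ps: "sets (\<pi> s') = sets (mdp_A m)"
      by (auto simp: space_prob_algebra)
    interpret prob_space "\<pi> s'" by (rule p)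
    have [measurable]: "f \<in> borel_measurable (mdp_S m \<Otimes>\<^sub>M mdp_A m)"
      using Qfuns_measurable[OF f] by (simp add: SA_def)
    have "(\<lambda>a. f (s', a)) \<in> borel_measurable (mdp_A m)"
      using s by measurable
    then have "integrable (\<pi> s') (\<lambda>a. f (s', a))"
      using Qfuns_bounds[OF f] s sets_eq_imp_space_eq[OF ps] ps
      by (intro integrable_const_bound[of _ "Cmax m"] AE_I2)
        (auto simp: SA_def space_pair_measure cong: measurable_cong_sets)
    then show "(\<integral>a'. r + mdp_disc m * f (s', a') \<partial>\<pi> s') = r + mdp_disc m * pol_eval \<pi> f s'"
      by (simp add: pol_eval_def prob_space)
  qed
  finally show ?thesis using x by (simp add: Bellman_def)
qed

lemma Bellman_Qfuns:
  assumes f: "f \<in> Qfuns m"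
  shows "Bellman m \<pi> f \<in> Qfuns m"
proof (rule QfunsI)
  have "(\<lambda>x. \<integral>z. target f z \<partial>sample_kernel x) \<in> borel_measurable (SA m)"
    by (rule integral_kernel_measurable[OF sample_kernel_measurable target_measurable[OF Qfuns_measurable[OF f]]])
  then show "Bellman m \<pi> f \<in> borel_measurable (SA m)"
    by (rule measurable_cong[THEN iffD1, rotated]) (simp add: Bellman_eq[OF f])
  fix x assume x: "x \<in> space (SA m)"
  interpret prob_space "sample_kernel x" by (rule sample_kernel_prob[OF x])
  show "0 \<le> Bellman m \<pi> f x"
    unfolding Bellman_eq[OF f x] using target_bounds[OF f] sample_kernel_prob[OF x]
    by (intro Bochner_Integration.integral_nonneg_AE AE_I2) auto
  show "Bellman m \<pi> f x \<le> Cmax m"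
    unfolding Bellman_eq[OF f x] using target_bounds[OF f] sample_kernel_prob[OF x]
    by (intro integral_le_const target_integrable f x AE_I2) auto
qed (simp add: Bellman_def)

section \<open>Population loss and its bias-variance decomposition\<close>

text \<open>The first argument is a function instead of an operator: the loss of \<open>A\<close> at
  \<open>f\<close> depends on \<open>A\<close> only through \<open>A f\<close>, and the Bellman
  image can then be inserted as well.\<close>

definition risk :: "('s \<times> 'a \<Rightarrow> real) \<Rightarrow> ('s \<times> 'a \<Rightarrow> real) \<Rightarrow> real" where
  "risk g f = (\<integral>z. (target f z - g (fst z))\<^sup>2 \<partial>sample_law m \<pi> \<mu>)"

definition sqerr :: "('s \<times> 'a \<Rightarrow> real) \<Rightarrow> ('s \<times> 'a \<Rightarrow> real) \<Rightarrow> real" where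
  "sqerr g f = (\<integral>x. (g x - Bellman m \<pi> f x)\<^sup>2 \<partial>\<mu>)"

lemma loss_measurable:
  assumes f: "f \<in> Qfuns m" and g: "g \<in> Qfuns m"
  shows "(\<lambda>z. (target f z - g (fst z))\<^sup>2) \<in> borel_measurable (sample_space m)"
proof -
  note [measurable] = target_measurable[OF Qfuns_measurable[OF f]] Qfuns_measurable[OF g]
  have "(\<lambda>z. g (fst z)) \<in> borel_measurable (sample_space m)"
    unfolding sample_space_def by measurable
  then show ?thesis by measurable
qed

lemma sq_le_sq_of_abs_le: "\<bar>u\<bar> \<le> c \<Longrightarrow> u\<^sup>2 \<le> c\<^sup>2" for u c :: real
  using power_mono[of "\<bar>u\<bar>" c 2] by simp

lemma sq_diff_bound: "0 \<le> u \<Longrightarrow> u \<le> c \<Longrightarrow> 0 \<le> v \<Longrightarrow> v \<le> c \<Longrightarrow> (u - v)\<^sup>2 \<le> c\<^sup>2" for u v c :: real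
  by (rule sq_le_sq_of_abs_le) auto

lemma loss_bound:
  assumes "f \<in> Qfuns m" "g \<in> Qfuns m" "z \<in> space (sample_space m)"
  shows "(target f z - g (fst z))\<^sup>2 \<le> (Cmax m)\<^sup>2"
proof (rule sq_diff_bound)
  have "fst z \<in> space (SA m)" using assms(3) by (auto elim: sample_space_cases)
  then show "0 \<le> g (fst z)" "g (fst z) \<le> Cmax m" using Qfuns_bounds[OF assms(2)] by auto
qed (use target_bounds[OF assms(1,3)] in auto)

text \<open>Given \<open>x\<close>, the prediction is a constant and the target has mean
  \<open>Bellman m \<pi> f x\<close>. Expanding the square leaves the conditional variance plus the
  squared bias.\<close>

lemma kernel_loss:
  assumes f: "f \<in> Qfuns m" and g: "g \<in> Qfuns m" and x: "x \<in> space (SA m)"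
  shows "(\<integral>z. (target f z - g (fst z))\<^sup>2 \<partial>sample_kernel x) =
    (\<integral>z. (target f z)\<^sup>2 \<partial>sample_kernel x) - (Bellman m \<pi> f x)\<^sup>2 + (g x - Bellman m \<pi> f x)\<^sup>2"
proof -
  interpret prob_space "sample_kernel x" by (rule sample_kernel_prob[OF x])
  note [measurable] = target_measurable[OF Qfuns_measurable[OF f]]
  have bd: "\<bar>(target f z - g x)\<^sup>2\<bar> \<le> (Cmax m)\<^sup>2" if "z \<in> space (sample_space m)" for z
    using sq_diff_bound[of "target f z" "Cmax m" "g x"] target_bounds[OF f that] Qfuns_bounds[OF g x]
    by simp
  \<comment> \<open>Passing to the iterated integral and back replaces \<open>fst z\<close> by
    \<open>x\<close>, since the kernel never changes the first coordinate.\<close>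
  have "(\<integral>z. (target f z - g (fst z))\<^sup>2 \<partial>sample_kernel x) =
      (\<integral>r. (\<integral>s'. (\<integral>a'. (target f (x, r, (s', a')) - g x)\<^sup>2 \<partial>\<pi> s') \<partial>mdp_T m x) \<partial>mdp_R m x)"
    using integral_sample_kernel[OF loss_measurable[OF f g] _ x, where c="(Cmax m)\<^sup>2"]
      loss_bound[OF f g] by simp
  also have "\<dots> = (\<integral>z. (target f z - g x)\<^sup>2 \<partial>sample_kernel x)"
    by (rule integral_sample_kernel[where c="(Cmax m)\<^sup>2", symmetric]) (use bd x in auto)
  also have "\<dots> = (\<integral>z. (target f z)\<^sup>2 - 2 * g x * target f z + (g x)\<^sup>2 \<partial>sample_kernel x)"
    by (simp add: power2_eq_square algebra_simps)
  also have "\<dots> = (\<integral>z. (target f z)\<^sup>2 \<partial>sample_kernel x) - 2 * g x * Bellman m \<pi> f x + (g x)\<^sup>2"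
  proof -
    have "integrable (sample_kernel x) (\<lambda>z. (target f z)\<^sup>2)"
      using sq_diff_bound[of "target f _" "Cmax m" 0] target_bounds[OF f] Cmax_ge_1
      by (intro integrable_kernel[where c="(Cmax m)\<^sup>2"] x) auto
    then show ?thesis
      using target_integrable[OF f x] by (simp add: Bellman_eq[OF f x] prob_space)
  qed
  finally show ?thesis by (simp add: power2_eq_square algebra_simps)
qed

lemma integrable_mu:
  fixes h :: "'s \<times> 'a \<Rightarrow> real"
  assumes "h \<in> borel_measurable (SA m)" "\<forall>x\<in>space (SA m). \<bar>h x\<bar> \<le> c"
  shows "integrable \<mu> h"
proof -
  interpret prob_space \<mu> by (rule prob_mu)
  show ?thesis
    using assms
    by (intro integrable_const_bound[of _ c] AE_I2) (auto simp: space_mu cong: measurable_cong_sets[OF sets_mu])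
qed

lemma integrable_sqdiff:
  assumes "f \<in> Qfuns m" "g \<in> Qfuns m"
  shows "integrable \<mu> (\<lambda>x. (g x - f x)\<^sup>2)"
proof (rule integrable_mu)
  note [measurable] = assms[THEN Qfuns_measurable]
  show "(\<lambda>x. (g x - f x)\<^sup>2) \<in> borel_measurable (SA m)" by measurable
  show "\<forall>x\<in>space (SA m). \<bar>(g x - f x)\<^sup>2\<bar> \<le> (Cmax m)\<^sup>2"
    using Qfuns_bounds[OF assms(1)] Qfuns_bounds[OF assms(2)] by (auto intro!: sq_diff_bound)
qed

text \<open>Averages the conditional identity over \<open>\<mu>\<close>. The noise term does not see
  \<open>g\<close>, and the choice of the Bellman image as \<open>g\<close>, where the bias
  vanishes, identifies it as a risk.\<close>

lemma risk_decomp: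
  assumes f: "f \<in> Qfuns m" and g: "g \<in> Qfuns m"
  shows "risk g f = risk (Bellman m \<pi> f) f + sqerr g f"
proof -
  let ?v = "\<lambda>x. (\<integral>z. (target f z)\<^sup>2 \<partial>sample_kernel x) - (Bellman m \<pi> f x)\<^sup>2"
  note B = Bellman_Qfuns[OF f]
  have risk: "risk h f = (\<integral>x. ?v x + (h x - Bellman m \<pi> f x)\<^sup>2 \<partial>\<mu>)" if h: "h \<in> Qfuns m" for h
  proof -
    have "risk h f = (\<integral>x. (\<integral>z. (target f z - h (fst z))\<^sup>2 \<partial>sample_kernel x) \<partial>\<mu>)"
      unfolding risk_def sample_law_eq
      by (rule integral_bind_prob_algebra[OF mu_in sample_kernel_measurable loss_measurable[OF f h]])
        (use loss_bound[OF f h] in auto)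
    also have "\<dots> = (\<integral>x. ?v x + (h x - Bellman m \<pi> f x)\<^sup>2 \<partial>\<mu>)"
      by (intro Bochner_Integration.integral_cong refl kernel_loss f h) (simp add: space_mu)
    finally show ?thesis .
  qed
  \<comment> \<open>The conditional variance is the conditional loss of the Bellman image itself,
    hence bounded by the square of \<open>Cmax m\<close>.\<close>
  have "integrable \<mu> ?v"
  proof -
    have "integrable \<mu> (\<lambda>x. \<integral>z. (target f z - Bellman m \<pi> f (fst z))\<^sup>2 \<partial>sample_kernel x)"
    proof (rule integrable_mu)
      show "\<forall>x\<in>space (SA m). \<bar>\<integral>z. (target f z - Bellman m \<pi> f (fst z))\<^sup>2 \<partial>sample_kernel x\<bar> \<le> (Cmax m)\<^sup>2"
      proof
        fix x assume x: "x \<in> space (SA m)"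
        interpret prob_space "sample_kernel x" by (rule sample_kernel_prob[OF x])
        show "\<bar>\<integral>z. (target f z - Bellman m \<pi> f (fst z))\<^sup>2 \<partial>sample_kernel x\<bar> \<le> (Cmax m)\<^sup>2"
          using loss_bound[OF f B] sample_kernel_prob[OF x]
          by (subst abs_of_nonneg)
            (auto intro!: integral_le_const integrable_kernel[where c="(Cmax m)\<^sup>2"] loss_measurable f B x AE_I2)
      qed
    qed (rule integral_kernel_measurable[OF sample_kernel_measurable loss_measurable[OF f B]])
    then show ?thesis
      by (rule Bochner_Integration.integrable_cong[THEN iffD1, rotated -1])
        (auto simp: space_mu kernel_loss[OF f B])
  qed
  then show ?thesis
    using integrable_sqdiff[OF B g] by (simp add: risk[OF g] risk[OF B] sqerr_def)
qed

lemma sqerr_nonneg: "0 \<le> sqerr g f"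
  by (simp add: sqerr_def)

section \<open>Norms of Bellman errors\<close>

lemma L2norm_eq_sqrt_sqerr:
  assumes "f \<in> Qfuns m" "g \<in> Qfuns m"
  shows "L2norm \<mu> (\<lambda>x. g x - Bellman m \<pi> f x) = ennreal (sqrt (sqerr g f))"
proof -
  have "(\<integral>\<^sup>+ x. ennreal ((g x - Bellman m \<pi> f x)\<^sup>2) \<partial>\<mu>) = ennreal (sqerr g f)"
    unfolding sqerr_def by (intro nn_integral_eq_integral integrable_sqdiff Bellman_Qfuns assms) auto
  then show ?thesis by (simp add: L2norm_def sqerr_nonneg)
qed

lemma sqerr_le_Cmax:
  assumes "f \<in> Qfuns m" "g \<in> Qfuns m"
  shows "sqerr g f \<le> (Cmax m)\<^sup>2"
proof -
  interpret prob_space \<mu> by (rule prob_mu)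
  note B = Bellman_Qfuns[OF assms(1)]
  show ?thesis
    unfolding sqerr_def using Qfuns_bounds[OF B] Qfuns_bounds[OF assms(2)]
    by (intro integral_le_const integrable_sqdiff B assms AE_I2 sq_diff_bound) (auto simp: space_mu)
qed

lemma Omega_app: "X \<in> Omega m \<Longrightarrow> f \<in> Qfuns m \<Longrightarrow> X f \<in> Qfuns m"
  by (auto simp: Omega_def)

lemma sqerr_le_op_err:
  assumes X: "X \<in> Omega m" and f: "f \<in> Qfuns m"
  shows "sqerr (X f) f \<le> (enn2real (op_err m \<pi> \<mu> X))\<^sup>2"
proof -
  \<comment> \<open>Finiteness has to come first: \<open>enn2real\<close> sends infinity to 0, which
    would spoil the passage to real numbers.\<close>
  have "op_err m \<pi> \<mu> X \<le> ennreal (Cmax m)"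
    unfolding op_err_def
  proof (rule SUP_least)
    fix h assume h: "h \<in> Qfuns m"
    have "sqrt (sqerr (X h) h) \<le> Cmax m"
      using sqerr_le_Cmax[OF h Omega_app[OF X h]] Cmax_ge_1 by (intro real_le_lsqrt) auto
    then show "L2norm \<mu> (\<lambda>x. X h x - Bellman m \<pi> h x) \<le> ennreal (Cmax m)"
      by (simp add: L2norm_eq_sqrt_sqerr[OF h Omega_app[OF X h]] ennreal_leI)
  qed
  then have fin: "op_err m \<pi> \<mu> X < top"
    using ennreal_less_top le_less_trans by blast
  have "ennreal (sqrt (sqerr (X f) f)) \<le> op_err m \<pi> \<mu> X"
    unfolding op_err_def L2norm_eq_sqrt_sqerr[OF f Omega_app[OF X f], symmetric]
    by (rule SUP_upper[OF f])
  then have "enn2real (ennreal (sqrt (sqerr (X f) f))) \<le> enn2real (op_err m \<pi> \<mu> X)"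
    using fin by (rule enn2real_mono)
  then have "(sqrt (sqerr (X f) f))\<^sup>2 \<le> (enn2real (op_err m \<pi> \<mu> X))\<^sup>2"
    by (intro power_mono) (auto simp: sqerr_nonneg)
  then show ?thesis by (simp add: sqerr_nonneg)
qed

section \<open>Bellman error of iterates and of their average\<close>

lemma Qiter_Qfuns: "X \<in> Omega m \<Longrightarrow> Qiter m X h \<in> Qfuns m"
proof (induction h)
  case 0
  have "(\<lambda>x\<in>space (SA m). 0 :: real) \<in> Qfuns m"
    using Cmax_ge_1 by (intro QfunsI restrict_borel_measurable) auto
  then show ?case by (simp only: Qiter.simps)
qed (simp add: Omega_app)

text \<open>The averaging branch of \<open>Qbar\<close>, studied on its own without a case
  distinction.\<close>

definition Qavg :: "nat \<Rightarrow> (('s \<times> 'a \<Rightarrow> real) \<Rightarrow> ('s \<times> 'a \<Rightarrow> real)) \<Rightarrow> 's \<times> 'a \<Rightarrow> real" where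
  "Qavg H X = (\<lambda>x\<in>space (SA m). (\<Sum>h=1..H. Qiter m X h x) / real H)"

lemma Qavg_Qfuns:
  assumes X: "X \<in> Omega m" and H: "1 \<le> H"
  shows "Qavg H X \<in> Qfuns m"
proof (rule QfunsI)
  note Q = Qiter_Qfuns[OF X]
  note [measurable] = Q[THEN Qfuns_measurable]
  show "Qavg H X \<in> borel_measurable (SA m)" 
    unfolding Qavg_def by (rule restrict_borel_measurable) measurable
  fix x assume x: "x \<in> space (SA m)"
  show "0 \<le> Qavg H X x"
    using x Qfuns_bounds[OF Q x] by (auto simp: Qavg_def intro!: divide_nonneg_nonneg sum_nonneg)
  have "(\<Sum>h=1..H. Qiter m X h x) \<le> (\<Sum>h=1..H. Cmax m)"
    using Qfuns_bounds[OF Q x] by (intro sum_mono) auto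
  then show "Qavg H X x \<le> Cmax m" using x H by (simp add: Qavg_def field_simps)
qed (simp add: Qavg_def)

lemma Qbar_Qfuns:
  assumes X: "X \<in> Omega m" and H: "1 \<le> H"
  shows "Qbar m H X \<in> Qfuns m"
  using Qiter_Qfuns[OF X] Qavg_Qfuns[OF assms] by (simp add: Qbar_def Qavg_def)

text \<open>The Bellman operator is affine and the weights 1/H sum to one, so the reward part passes
  through the average unchanged.\<close>

lemma Bellman_Qavg:
  assumes X: "X \<in> Omega m" and H: "1 \<le> H" and x: "x \<in> space (SA m)"
  shows "Bellman m \<pi> (Qavg H X) x = (\<Sum>h=1..H. Bellman m \<pi> (Qiter m X h) x) / real H"
proof -
  have "Bellman m \<pi> (Qavg H X) x = (\<integral>z. (\<Sum>h=1..H. target (Qiter m X h) z) / real H \<partial>sample_kernel x)"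
    unfolding Bellman_eq[OF Qavg_Qfuns[OF X H] x]
  proof (intro Bochner_Integration.integral_cong refl)
    fix z assume "z \<in> space (sample_kernel x)"
    then have "z \<in> space (sample_space m)" using sample_kernel_prob(3)[OF x] by simp
    then obtain x' r y where "z = (x', r, y)" "y \<in> space (SA m)" by (rule sample_space_cases)
    then show "target (Qavg H X) z = (\<Sum>h=1..H. target (Qiter m X h) z) / real H"
      using H by (simp add: target_def Qavg_def sum.distrib sum_distrib_left field_simps)
  qed
  also have "\<dots> = (\<Sum>h=1..H. \<integral>z. target (Qiter m X h) z \<partial>sample_kernel x) / real H"
    using target_integrable[OF Qiter_Qfuns[OF X] x] by simp
  also have "\<dots> = (\<Sum>h=1..H. Bellman m \<pi> (Qiter m X h) x) / real H"
    by (simp add: Bellman_eq[OF Qiter_Qfuns[OF X] x])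
  finally show ?thesis .
qed

text \<open>The triangle inequality in L2 for a perturbation \<open>v\<close> bounded uniformly by
  \<open>b\<close>: after expanding the square, only the mean of \<bar>D\<bar> is left to
  control.\<close>

lemma sqerr_perturb:
  fixes D v :: "'s \<times> 'a \<Rightarrow> real" and b c e :: real
  assumes D: "D \<in> borel_measurable (SA m)" and Db: "\<forall>x\<in>space (SA m). \<bar>D x\<bar> \<le> c"
    and v: "v \<in> borel_measurable (SA m)" and vb: "\<forall>x\<in>space (SA m). \<bar>v x\<bar> \<le> b"
    and e: "(\<integral>x. (D x)\<^sup>2 \<partial>\<mu>) \<le> e\<^sup>2" "0 \<le> e" and b: "0 \<le> b"
  shows "(\<integral>x. (D x + v x)\<^sup>2 \<partial>\<mu>) \<le> (e + b)\<^sup>2"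
proof -
  interpret prob_space \<mu> by (rule prob_mu)
  note [measurable] = D v
  let ?a = "\<integral>x. \<bar>D x\<bar> \<partial>\<mu>"
  have iA: "integrable \<mu> (\<lambda>x. \<bar>D x\<bar>)" by (rule integrable_mu[of _ c]) (use Db in auto)
  have i2: "integrable \<mu> (\<lambda>x. (D x)\<^sup>2)"
    by (rule integrable_mu[of _ "c\<^sup>2"]) (use Db in \<open>auto intro: sq_le_sq_of_abs_le\<close>)
  have isq: "integrable \<mu> (\<lambda>x. (D x + v x)\<^sup>2)"
  proof (rule integrable_mu[of _ "(c + b)\<^sup>2"])
    show "\<forall>x\<in>space (SA m). \<bar>(D x + v x)\<^sup>2\<bar> \<le> (c + b)\<^sup>2"
    proof
      fix x assume "x \<in> space (SA m)"
      then have "\<bar>D x\<bar> \<le> c" "\<bar>v x\<bar> \<le> b" using Db vb by auto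
      then have "\<bar>D x + v x\<bar> \<le> c + b" by linarith
      then show "\<bar>(D x + v x)\<^sup>2\<bar> \<le> (c + b)\<^sup>2" using sq_le_sq_of_abs_le by simp
    qed
  qed measurable
  \<comment> \<open>Nonnegativity of the variance of \<bar>D\<bar> bounds its mean by its L2
    norm.\<close>
  have "0 \<le> (\<integral>x. (\<bar>D x\<bar> - ?a)\<^sup>2 \<partial>\<mu>)" by simp
  also have "\<dots> = (\<integral>x. (D x)\<^sup>2 \<partial>\<mu>) - ?a\<^sup>2"
    using variance_eq[OF iA] i2 by simp
  finally have "?a\<^sup>2 \<le> e\<^sup>2" using e(1) by linarith
  then have a: "?a \<le> e" using e(2) by (rule power2_le_imp_le)
  have "(\<integral>x. (D x + v x)\<^sup>2 \<partial>\<mu>) \<le> (\<integral>x. (D x)\<^sup>2 + 2 * b * \<bar>D x\<bar> + b\<^sup>2 \<partial>\<mu>)"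
  proof (rule integral_mono[OF isq])
    fix x assume "x \<in> space \<mu>"
    then have vx: "\<bar>v x\<bar> \<le> b" using vb by (simp add: space_mu)
    have "(D x + v x)\<^sup>2 \<le> (\<bar>D x\<bar> + \<bar>v x\<bar>)\<^sup>2"
      by (intro abs_le_square_iff[THEN iffD1]) linarith
    also have "\<dots> \<le> (\<bar>D x\<bar> + b)\<^sup>2" using vx by (intro power_mono) auto
    finally show "(D x + v x)\<^sup>2 \<le> (D x)\<^sup>2 + 2 * b * \<bar>D x\<bar> + b\<^sup>2"
      by (simp add: power2_sum algebra_simps)
  qed (use iA i2 in simp)
  also have "\<dots> = (\<integral>x. (D x)\<^sup>2 \<partial>\<mu>) + 2 * b * ?a + b\<^sup>2"
    using iA i2 by (simp add: prob_space)
  also have "\<dots> \<le> e\<^sup>2 + 2 * b * e + b\<^sup>2" using a b e by (intro add_mono mult_left_mono) auto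
  finally show ?thesis by (simp add: power2_sum algebra_simps)
qed

lemma average_bounded:
  fixes d :: "nat \<Rightarrow> real"
  assumes "\<And>h. \<bar>d h\<bar> \<le> c" "1 \<le> H"
  shows "\<bar>(\<Sum>h<H. d h) / real H\<bar> \<le> c"
proof -
  have "\<bar>\<Sum>h<H. d h\<bar> \<le> (\<Sum>h<H. \<bar>d h\<bar>)" by (rule sum_abs)
  also have "\<dots> \<le> (\<Sum>h<H. c)" by (rule sum_mono) (rule assms)
  finally show ?thesis using assms(2) by (simp add: field_simps)
qed

text \<open>Convexity of the square: by Cauchy-Schwarz, the squared average is pointwise at most the
  average of the squares.\<close>

lemma sq_average_le:
  fixes d :: "nat \<Rightarrow> 's \<times> 'a \<Rightarrow> real"
  assumes d [measurable]: "\<And>h. d h \<in> borel_measurable (SA m)"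
    and db: "\<And>h x. x \<in> space (SA m) \<Longrightarrow> \<bar>d h x\<bar> \<le> c"
    and e: "\<And>h. (\<integral>x. (d h x)\<^sup>2 \<partial>\<mu>) \<le> e" and H: "1 \<le> H"
  shows "(\<integral>x. ((\<Sum>h<H. d h x) / real H)\<^sup>2 \<partial>\<mu>) \<le> e"
proof -
  have id: "integrable \<mu> (\<lambda>x. (d h x)\<^sup>2)" for h
    by (rule integrable_mu[of _ "c\<^sup>2"]) (use db in \<open>auto intro: sq_le_sq_of_abs_le\<close>)
  have "(\<integral>x. ((\<Sum>h<H. d h x) / real H)\<^sup>2 \<partial>\<mu>) \<le> (\<integral>x. (\<Sum>h<H. (d h x)\<^sup>2) / real H \<partial>\<mu>)"
  proof (rule integral_mono)
    show "integrable \<mu> (\<lambda>x. ((\<Sum>h<H. d h x) / real H)\<^sup>2)"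
    proof (rule integrable_mu[of _ "c\<^sup>2"])
      show "\<forall>x\<in>space (SA m). \<bar>((\<Sum>h<H. d h x) / real H)\<^sup>2\<bar> \<le> c\<^sup>2"
        using sq_le_sq_of_abs_le[OF average_bounded[OF _ H]] db by simp
    qed measurable
    show "integrable \<mu> (\<lambda>x. (\<Sum>h<H. (d h x)\<^sup>2) / real H)" using id by simp
    fix x
    have "(\<Sum>h<H. d h x)\<^sup>2 \<le> (\<Sum>h<H. (d h x)\<^sup>2) * real H"
      using sum_squared_le_sum_of_squares[of "\<lambda>h. d h x" "{..<H}"] by simp
    then show "((\<Sum>h<H. d h x) / real H)\<^sup>2 \<le> (\<Sum>h<H. (d h x)\<^sup>2) / real H"
      using H by (simp add: power_divide power2_eq_square field_simps)
  qed
  also have "\<dots> = (\<Sum>h<H. \<integral>x. (d h x)\<^sup>2 \<partial>\<mu>) / real H" using id by simp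
  also have "\<dots> \<le> (\<Sum>h<H. e) / real H"
    using e by (intro divide_right_mono sum_mono) auto
  also have "\<dots> = e" using H by simp
  finally show ?thesis .
qed

lemma sqerr_Qavg:
  assumes X: "X \<in> Omega m" and H: "1 \<le> H"
  shows "sqerr (Qavg H X) (Qavg H X) \<le> (enn2real (op_err m \<pi> \<mu> X) + Cmax m / real H)\<^sup>2"
proof -
  let ?e = "enn2real (op_err m \<pi> \<mu> X)"
  define Q B where "Q = Qiter m X" and "B = (\<lambda>h. Bellman m \<pi> (Q h))"
  have Q: "Q h \<in> Qfuns m" for h unfolding Q_def by (rule Qiter_Qfuns[OF X])
  have B: "B h \<in> Qfuns m" for h unfolding B_def by (rule Bellman_Qfuns[OF Q])
  note [measurable] = Q[THEN Qfuns_measurable] B[THEN Qfuns_measurable]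
  \<comment> \<open>The operator error of \<open>X\<close> at the iterate \<open>Q h\<close>, since
    \<open>Q (Suc h)\<close> is \<open>X (Q h)\<close>.\<close>
  define d where "d h x = Q (Suc h) x - B h x" for h x
  define v where "v x = (B 0 x - B H x) / real H" for x
  \<comment> \<open>The average runs over 1..H, while the errors pair \<open>Q (Suc h)\<close> with
    \<open>B h\<close> for h < H. Shifting the sum of Bellman images by one index leaves only the
    two end terms.\<close>
  have tele: "(\<Sum>h=1..K. Q h x) - (\<Sum>h=1..K. B h x) = (\<Sum>h<K. d h x) + (B 0 x - B K x)" for K x
    by (induction K) (auto simp: d_def)
  have split: "Qavg H X x - Bellman m \<pi> (Qavg H X) x = (\<Sum>h<H. d h x) / real H + v x"
    if x: "x \<in> space (SA m)" for x
  proof -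
    have "Qavg H X x = (\<Sum>h=1..H. Q h x) / real H" using x by (simp add: Qavg_def Q_def)
    moreover have "Bellman m \<pi> (Qavg H X) x = (\<Sum>h=1..H. B h x) / real H"
      unfolding B_def Q_def by (rule Bellman_Qavg[OF X H x])
    ultimately have "Qavg H X x - Bellman m \<pi> (Qavg H X) x = ((\<Sum>h=1..H. Q h x) - (\<Sum>h=1..H. B h x)) / real H"
      by (simp only: diff_divide_distrib)
    also have "\<dots> = (\<Sum>h<H. d h x) / real H + v x"
      unfolding tele v_def by (rule add_divide_distrib)
    finally show ?thesis .
  qed
  have dm [measurable]: "d h \<in> borel_measurable (SA m)" for h unfolding d_def[abs_def] by measurable
  have db: "\<bar>d h x\<bar> \<le> Cmax m" if "x \<in> space (SA m)" for h x
    using Qfuns_bounds[OF Q that, of "Suc h"] Qfuns_bounds[OF B that, of h] by (simp add: d_def)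
  have D: "(\<integral>x. ((\<Sum>h<H. d h x) / real H)\<^sup>2 \<partial>\<mu>) \<le> ?e\<^sup>2"
  proof (rule sq_average_le[OF dm db _ H])
    show "(\<integral>x. (d h x)\<^sup>2 \<partial>\<mu>) \<le> ?e\<^sup>2" for h
      using sqerr_le_op_err[OF X Q, of h] by (simp add: sqerr_def d_def B_def Q_def)
  qed
  have vb: "\<forall>x\<in>space (SA m). \<bar>v x\<bar> \<le> Cmax m / real H"
  proof
    fix x assume x: "x \<in> space (SA m)"
    have "\<bar>B 0 x - B H x\<bar> \<le> Cmax m"
      using Qfuns_bounds[OF B x, of 0] Qfuns_bounds[OF B x, of H] by linarith
    then show "\<bar>v x\<bar> \<le> Cmax m / real H" by (simp add: v_def divide_right_mono)
  qed
  have "sqerr (Qavg H X) (Qavg H X) = (\<integral>x. ((\<Sum>h<H. d h x) / real H + v x)\<^sup>2 \<partial>\<mu>)"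
    unfolding sqerr_def
    by (intro Bochner_Integration.integral_cong refl arg_cong[where f="\<lambda>u. u\<^sup>2"] split) (simp add: space_mu)
  also have "\<dots> \<le> (?e + Cmax m / real H)\<^sup>2"
  proof (rule sqerr_perturb[OF _ _ _ vb D])
    show "\<forall>x\<in>space (SA m). \<bar>(\<Sum>h<H. d h x) / real H\<bar> \<le> Cmax m"
      using average_bounded[OF _ H, of "\<lambda>h. d h _"] db by blast
    show "v \<in> borel_measurable (SA m)" unfolding v_def[abs_def] by measurable
    show "(\<lambda>x. (\<Sum>h<H. d h x) / real H) \<in> borel_measurable (SA m)" by measurable
    show "0 \<le> Cmax m / real H" using Cmax_ge_1 by simp
  qed simp
  finally show ?thesis .
qed

lemma sqerr_Qbar:
  assumes X: "X \<in> Omega m" and H: "1 \<le> H"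
  shows "sqerr (Qbar m H X) (Qbar m H X) \<le> (enn2real (op_err m \<pi> \<mu> X) + Cmax m / real H)\<^sup>2"
proof (cases "\<exists>h\<in>{1..H}. Qiter m X h = Qiter m X (h - 1)")
  case True
  define k where "k = (LEAST h. h \<in> {1..H} \<and> Qiter m X h = Qiter m X (h - 1))"
  \<comment> \<open>The stopping index is at least 1, so it has a predecessor \<open>j\<close>, and
    \<open>Qiter m X j\<close> is a fixed point of \<open>X\<close>.\<close>
  have "\<exists>h. h \<in> {1..H} \<and> Qiter m X h = Qiter m X (h - 1)" using True by blast
  then have "k \<in> {1..H} \<and> Qiter m X k = Qiter m X (k - 1)"
    unfolding k_def by (rule LeastI_ex)
  then obtain j where j: "k = Suc j" "X (Qiter m X j) = Qiter m X j"
    by (cases k) (simp, metis Qiter.simps(2) diff_Suc_1)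
  have "Qbar m H X = Qiter m X k" unfolding Qbar_def k_def by (rule if_P[OF True])
  also have "\<dots> = Qiter m X j" unfolding j(1) Qiter.simps(2) by (rule j(2))
  finally have Q: "Qbar m H X = Qiter m X j" .
  \<comment> \<open>At a fixed point the Bellman error is exactly the operator error of
    \<open>X\<close>.\<close>
  have "sqerr (Qiter m X j) (Qiter m X j) \<le> (enn2real (op_err m \<pi> \<mu> X))\<^sup>2"
    using sqerr_le_op_err[OF X Qiter_Qfuns[OF X], of j] by (simp only: j(2))
  also have "\<dots> \<le> (enn2real (op_err m \<pi> \<mu> X) + Cmax m / real H)\<^sup>2"
    using Cmax_ge_1 by (intro power_mono) auto
  finally show ?thesis unfolding Q .
next
  case False
  have "Qbar m H X = Qavg H X" unfolding Qbar_def Qavg_def by (rule if_not_P[OF False])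
  then show ?thesis using sqerr_Qavg[OF assms] by (simp only:)
qed

section \<open>Concentration of the empirical losses\<close>

lemma sq_loss_eq:
  "sq_loss (mdp_disc m) n d A f = (\<Sum>i<n. (target f (d i) - A f (fst (d i)))\<^sup>2) / real n"
  by (simp add: sq_loss_def target_def case_prod_unfold)

text \<open>Neither \<open>f\<close> nor \<open>A\<close> depends on the data, so the individual
  losses are i.i.d. with mean \<open>risk (A f) f\<close> and Hoeffding's inequality
  applies.\<close>

lemma loss_concentration:
  assumes D: "is_dataset m \<pi> \<mu> n M D" and n: "1 \<le> n" and f: "f \<in> Qfuns m" and Af: "A f \<in> Qfuns m"
    and \<epsilon>: "0 \<le> \<epsilon>"
  shows "measure M {\<omega>\<in>space M. \<epsilon> \<le> \<bar>sq_loss (mdp_disc m) n (\<lambda>i. D i \<omega>) A f - risk (A f) f\<bar>}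
      \<le> 2 * exp (- (2 * real n * \<epsilon>\<^sup>2 / ((Cmax m)\<^sup>2)\<^sup>2))" (is "?P \<le> _")
    and "{\<omega>\<in>space M. \<epsilon> \<le> \<bar>sq_loss (mdp_disc m) n (\<lambda>i. D i \<omega>) A f - risk (A f) f\<bar>} \<in> sets M"
proof -
  let ?l = "\<lambda>z. (target f z - A f (fst z))\<^sup>2"
  interpret prob_space M using D by (simp add: is_dataset_def)
  have ind: "indep_vars (\<lambda>_. sample_space m) D {..<n}"
    and law: "\<And>i. i < n \<Longrightarrow> distr M (sample_space m) (D i) = sample_law m \<pi> \<mu>"
    using D by (auto simp: is_dataset_def)
  have rv: "random_variable (sample_space m) (D i)" if "i < n" for i
    using ind that by (auto simp: indep_vars_def)
  note l [measurable] = loss_measurable[OF f Af]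
  have lm: "random_variable borel (\<lambda>\<omega>. ?l (D i \<omega>))" if "i < n" for i
    using rv[OF that] by (rule measurable_compose) (rule l)
  have lawl: "distr M borel (\<lambda>\<omega>. ?l (D i \<omega>)) = distr (sample_law m \<pi> \<mu>) borel ?l" if "i < n" for i
    using distr_distr[OF l rv[OF that]] law[OF that] by (simp add: comp_def)
  have "expectation (\<lambda>\<omega>. ?l (D 0 \<omega>)) = (\<integral>z. ?l z \<partial>distr M (sample_space m) (D 0))"
    using n by (intro integral_distr[symmetric] rv l) auto
  then have ex: "expectation (\<lambda>\<omega>. ?l (D 0 \<omega>)) = risk (A f) f"
    using law[of 0] n by (simp add: risk_def)
  \<comment> \<open>Each loss lies in an interval whose length is the square of
    \<open>Cmax m\<close>; Hoeffding's exponent squares this length again.\<close>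
  interpret H: Hoeffding_ineq_iid M "{..<n}" "\<lambda>i \<omega>. ?l (D i \<omega>)" "\<lambda>\<omega>. ?l (D 0 \<omega>)" 0 "(Cmax m)\<^sup>2"
    "expectation (\<lambda>\<omega>. ?l (D 0 \<omega>))"
  proof (unfold_locales)
    show "indep_vars (\<lambda>_. borel) (\<lambda>i \<omega>. ?l (D i \<omega>)) {..<n}"
      using ind by (rule indep_vars_compose2) (rule l)
    show "distr M borel (\<lambda>\<omega>. ?l (D i \<omega>)) = distr M borel (\<lambda>\<omega>. ?l (D 0 \<omega>))" if "i \<in> {..<n}" for i
      using that n lawl[of i] lawl[of 0] by simp
    show "random_variable borel (\<lambda>\<omega>. ?l (D 0 \<omega>))" using lm n by simp
    show "AE \<omega> in M. ?l (D 0 \<omega>) \<in> {0..(Cmax m)\<^sup>2}"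
      using measurable_space[OF rv[of 0]] n loss_bound[OF f Af] by (intro AE_I2) auto
  qed auto
  have ne: "{..<n} \<noteq> {}" using n by (simp add: lessThan_empty_iff)
  show "?P \<le> 2 * exp (- (2 * real n * \<epsilon>\<^sup>2 / ((Cmax m)\<^sup>2)\<^sup>2))"
    using H.Hoeffding_ineq_abs_ge'[OF \<epsilon> _ ne] Cmax_ge_1 by (simp add: sq_loss_eq ex del: H.expectation_X)
  have "(\<lambda>\<omega>. sq_loss (mdp_disc m) n (\<lambda>i. D i \<omega>) A f) \<in> borel_measurable M"
    unfolding sq_loss_eq using lm by (intro borel_measurable_divide borel_measurable_sum) auto
  then show "{\<omega>\<in>space M. \<epsilon> \<le> \<bar>sq_loss (mdp_disc m) n (\<lambda>i. D i \<omega>) A f - risk (A f) f\<bar>} \<in> sets M"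
    by measurable
qed

text \<open>
  The radius at which Hoeffding's bound, summed over the at most \<open>2 k\<^sup>2\<close> pairs of a candidate value
  function and a comparator, equals \<open>\<delta>\<close>.
\<close>

definition conc_radius :: "nat \<Rightarrow> nat \<Rightarrow> real \<Rightarrow> real" where
  "conc_radius k n \<delta> = (Cmax m)\<^sup>2 * sqrt (ln (4 * (real k)\<^sup>2 / \<delta>) / (2 * real n))"

text \<open>Before the data are seen there are only finitely many possible value functions
  \<open>Qbar m H X\<close>, so a union bound covers the data-dependent choice. The comparator
  \<open>id\<close> is included because the regret also evaluates its loss.\<close>

lemma uniform_concentration:
  assumes D: "is_dataset m \<pi> \<mu> n M D" and n: "1 \<le> n" and H: "1 \<le> H"
    and XX: "finite XX" "XX \<noteq> {}" "XX \<subseteq> Omega m" and \<delta>: "0 < \<delta>" "\<delta> < 1"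
  defines "\<epsilon> \<equiv> conc_radius (card XX) n \<delta>"
  obtains G where "G \<in> sets M" "1 - \<delta> \<le> measure M G"
    "\<And>\<omega> X A. \<omega> \<in> G \<Longrightarrow> X \<in> XX \<Longrightarrow> A \<in> insert id XX \<Longrightarrow>
      \<bar>sq_loss (mdp_disc m) n (\<lambda>i. D i \<omega>) A (Qbar m H X) - risk (A (Qbar m H X)) (Qbar m H X)\<bar> \<le> \<epsilon>"
proof
  interpret prob_space M using D by (simp add: is_dataset_def)
  define bad where "bad p = {\<omega>\<in>space M. \<epsilon> \<le> \<bar>sq_loss (mdp_disc m) n (\<lambda>i. D i \<omega>) (snd p) (Qbar m H (fst p))
    - risk (snd p (Qbar m H (fst p))) (Qbar m H (fst p))\<bar>}" for p
  let ?I = "XX \<times> insert id XX" and ?k = "real (card XX)"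
  define L where "L = ln (4 * ?k\<^sup>2 / \<delta>)"
  have k: "1 \<le> ?k" using XX(1,2) by (simp add: Suc_le_eq card_gt_0_iff)
  then have k2: "1 \<le> ?k\<^sup>2" by simp
  then have "1 \<le> 4 * ?k\<^sup>2 / \<delta>" using \<delta> by (simp add: field_simps)
  then have L: "0 \<le> L" by (simp add: L_def)
  have \<epsilon>: "0 \<le> \<epsilon>" using L by (simp add: \<epsilon>_def conc_radius_def L_def[symmetric])
  \<comment> \<open>The radius was defined by solving this equation for
    \<open>\<epsilon>\<close>.\<close>
  have exponent: "2 * real n * \<epsilon>\<^sup>2 / ((Cmax m)\<^sup>2)\<^sup>2 = L"
    using L n Cmax_ge_1 by (simp add: \<epsilon>_def conc_radius_def L_def[symmetric] power_mult_distrib)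
  have bad: "bad p \<in> sets M" "measure M (bad p) \<le> 2 * exp (- L)" if "p \<in> ?I" for p
  proof -
    have Q: "Qbar m H (fst p) \<in> Qfuns m" using that XX(3) by (intro Qbar_Qfuns H) auto
    then have A: "snd p (Qbar m H (fst p)) \<in> Qfuns m"
      using that XX(3) Omega_app[OF _ Q, of "snd p"] Q by auto
    show "bad p \<in> sets M" unfolding bad_def by (rule loss_concentration(2)[where A="snd p", OF D n Q A \<epsilon>])
    show "measure M (bad p) \<le> 2 * exp (- L)"
      unfolding bad_def using loss_concentration(1)[where A="snd p", OF D n Q A \<epsilon>] by (simp only: exponent)
  qed
  have fin: "finite ?I" using XX(1) by simp
  have "measure M (\<Union>p\<in>?I. bad p) \<le> (\<Sum>p\<in>?I. measure M (bad p))"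
    using bad fin by (intro finite_measure_subadditive_finite) auto
  also have "\<dots> \<le> (\<Sum>p\<in>?I. 2 * exp (- L))" by (rule sum_mono) (rule bad)
  also have "\<dots> = real (card ?I) * (2 * exp (- L))" by simp
  \<comment> \<open>There are at most k (k + 1) pairs, and k + 1 \<le> 2 k for a nonempty
    class.\<close>
  also have "\<dots> \<le> (2 * ?k\<^sup>2) * (2 * exp (- L))"
  proof (rule mult_right_mono)
    have "card ?I \<le> card XX * (card XX + 1)"
      unfolding card_cartesian_product using card_insert_le_m1[of "card XX + 1" XX id] XX(1)
      by (intro mult_left_mono) auto
    then have "real (card ?I) \<le> real (card XX * (card XX + 1))" by (simp only: of_nat_le_iff)
    also have "\<dots> = ?k * (?k + 1)" by (simp add: algebra_simps)
    also have "\<dots> \<le> ?k * (2 * ?k)" using k by (intro mult_left_mono) auto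
    finally show "real (card ?I) \<le> 2 * ?k\<^sup>2" by (simp add: power2_eq_square)
  qed simp
  also have "\<dots> = \<delta>" using \<delta> k by (simp add: L_def exp_minus)
  finally have b: "measure M (\<Union>p\<in>?I. bad p) \<le> \<delta>" .
  let ?G = "space M - (\<Union>p\<in>?I. bad p)"
  have bs: "(\<Union>p\<in>?I. bad p) \<in> events" using bad fin by (intro sets.finite_UN) auto
  then show "?G \<in> sets M" by auto
  show "1 - \<delta> \<le> measure M ?G" using b prob_compl[OF bs] by simp
  show "\<bar>sq_loss (mdp_disc m) n (\<lambda>i. D i \<omega>) A (Qbar m H X) - risk (A (Qbar m H X)) (Qbar m H X)\<bar> \<le> \<epsilon>"
    if "\<omega> \<in> ?G" "X \<in> XX" "A \<in> insert id XX" for \<omega> X A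
  proof -
    have "\<omega> \<notin> bad (X, A)" using that by blast
    then show ?thesis using that(1) by (simp add: bad_def)
  qed
qed

section \<open>Comparison of regrets\<close>

text \<open>A deterministic statement about one data sequence \<open>d\<close>; randomness enters
  only through \<open>conc\<close>. In each regret the noise terms of the two losses cancel, so only
  squared Bellman errors survive.\<close>

lemma selection_error:
  assumes XX: "finite XX" "XX \<subseteq> Omega m" and H: "1 \<le> H" and Xs: "Xs \<in> XX"
    and argmin: "is_arg_min (\<lambda>X. fp_regret (mdp_disc m) n d (Qbar m H X) XX) (\<lambda>X. X \<in> XX) Xh"
    and conc: "\<And>X A. X \<in> XX \<Longrightarrow> A \<in> insert id XX \<Longrightarrow>
      \<bar>sq_loss (mdp_disc m) n d A (Qbar m H X) - risk (A (Qbar m H X)) (Qbar m H X)\<bar> \<le> \<epsilon>"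
  defines "e \<equiv> enn2real (op_err m \<pi> \<mu> Xs)"
  shows "sqerr (Qbar m H Xh) (Qbar m H Xh) \<le> (e + Cmax m / real H)\<^sup>2 + e\<^sup>2 + 4 * \<epsilon>"
proof -
  let ?L = "sq_loss (mdp_disc m) n d"
  define f g where "f = Qbar m H Xh" and "g = Qbar m H Xs"
  have Xh: "Xh \<in> XX" and "\<not> fp_regret (mdp_disc m) n d g XX < fp_regret (mdp_disc m) n d f XX"
    using argmin Xs unfolding is_arg_min_def f_def g_def by blast+
  then have reg: "?L id f - (MIN A\<in>XX. ?L A f) \<le> ?L id g - (MIN A\<in>XX. ?L A g)"
    unfolding fp_regret_def by linarith
  have fQ: "f \<in> Qfuns m" and gQ: "g \<in> Qfuns m"
    unfolding f_def g_def using Xh Xs XX(2) by (auto intro!: Qbar_Qfuns H)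
  \<comment> \<open>At \<open>g\<close> the minimum is attained by some \<open>A\<close>, whose
    squared error is nonnegative and is dropped at the end; at \<open>f\<close> the minimum is
    bounded by the loss of \<open>Xs\<close>.\<close>
  have "(MIN A\<in>XX. ?L A g) \<in> (\<lambda>A. ?L A g) ` XX" using XX(1) Xs by (intro Min_in) auto
  then obtain A where A: "A \<in> XX" "(MIN A\<in>XX. ?L A g) = ?L A g" by blast
  have min_f: "(MIN A\<in>XX. ?L A f) \<le> ?L Xs f"
    using XX(1) Xs by (intro Min_le finite_imageI imageI)
  have XsQ: "Xs f \<in> Qfuns m" and AQ: "A g \<in> Qfuns m"
    using Xs A(1) XX(2) Omega_app[OF _ fQ] Omega_app[OF _ gQ] by blast+
  \<comment> \<open>Four empirical losses are exchanged for risks, each at a cost of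
    \<open>\<epsilon>\<close>.\<close>
  have "risk f f - \<epsilon> \<le> ?L id f"
    using conc[OF Xh insertI1] unfolding f_def[symmetric] id_apply abs_le_iff by linarith
  moreover have "?L Xs f \<le> risk (Xs f) f + \<epsilon>"
    using conc[OF Xh insertI2[OF Xs]] unfolding f_def[symmetric] abs_le_iff by linarith
  moreover have "?L id g \<le> risk g g + \<epsilon>"
    using conc[OF Xs insertI1] unfolding g_def[symmetric] id_apply abs_le_iff by linarith
  moreover have "risk (A g) g - \<epsilon> \<le> ?L A g"
    using conc[OF Xs insertI2[OF A(1)]] unfolding g_def[symmetric] abs_le_iff by linarith
  ultimately have "sqerr f f \<le> sqerr g g + sqerr (Xs f) f - sqerr (A g) g + 4 * \<epsilon>"
    using reg min_f A(2) risk_decomp[OF fQ fQ] risk_decomp[OF fQ XsQ] risk_decomp[OF gQ gQ]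
      risk_decomp[OF gQ AQ] by linarith
  moreover have "sqerr g g \<le> (e + Cmax m / real H)\<^sup>2"
    unfolding e_def g_def using Xs XX(2) by (intro sqerr_Qbar H) auto
  moreover have "sqerr (Xs f) f \<le> e\<^sup>2"
    unfolding e_def using Xs XX(2) by (intro sqerr_le_op_err fQ) auto
  ultimately show ?thesis using sqerr_nonneg[of "A g" g] unfolding f_def[symmetric] by linarith
qed

end

section \<open>Link functions and the form of the confidence term\<close>

lemma is_link_subadditive:
  assumes \<phi>: "is_link \<phi>" and ab: "0 \<le> a" "0 \<le> b"
  shows "\<phi> (a + b) \<le> \<phi> a + \<phi> b"
proof (cases "a + b = 0")
  case True
  then show ?thesis using ab \<phi> by (simp add: is_link_def)
next
  case False
  then have pos: "0 < a + b" using ab by simp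
  \<comment> \<open>Concavity on the segment from 0 to a + b with \<phi> 0 = 0. The fractions
    a/(a+b) and b/(a+b) sum to one, so adding the two instances gives subadditivity.\<close>
  have star: "t * \<phi> (a + b) \<le> \<phi> (t * (a + b))" if "0 \<le> t" "t \<le> 1" for t
    using concave_onD[of "{0..}" \<phi> t 0 "a + b"] \<phi> that pos by (simp add: is_link_def)
  have "a / (a + b) * \<phi> (a + b) \<le> \<phi> a" "b / (a + b) * \<phi> (a + b) \<le> \<phi> b"
    using star[of "a / (a + b)"] star[of "b / (a + b)"] ab pos by (auto simp: divide_simps)
  moreover have "a / (a + b) * \<phi> (a + b) + b / (a + b) * \<phi> (a + b) = \<phi> (a + b)"
    using pos by (simp add: distrib_right[symmetric] add_divide_distrib[symmetric])
  ultimately show ?thesis by linarith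
qed

lemma is_link_nonneg: "is_link \<phi> \<Longrightarrow> 0 \<le> a \<Longrightarrow> 0 \<le> \<phi> a"
  by (simp add: is_link_def)

lemma is_link_mono: "is_link \<phi> \<Longrightarrow> 0 \<le> a \<Longrightarrow> a \<le> b \<Longrightarrow> \<phi> a \<le> \<phi> b"
  by (auto simp: is_link_def mono_on_def)

text \<open>The square of the right-hand side is the assumed bound plus nonnegative products of
  \<open>e\<close>, \<open>b\<close> and \<open>sqrt \<epsilon>\<close>.\<close>

lemma sqrt_error_bound:
  fixes e b \<epsilon> s :: real
  assumes "s \<le> (e + b)\<^sup>2 + e\<^sup>2 + 4 * \<epsilon>" "0 \<le> e" "0 \<le> b" "0 \<le> \<epsilon>"
  shows "sqrt s \<le> 2 * e + (b + 2 * sqrt \<epsilon>)"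
proof (rule real_le_lsqrt)
  have "0 \<le> e * e" "0 \<le> e * b" "0 \<le> e * sqrt \<epsilon>" "0 \<le> b * sqrt \<epsilon>" and "(sqrt \<epsilon>)\<^sup>2 = \<epsilon>"
    using assms by auto
  moreover have "(2 * e + (b + 2 * sqrt \<epsilon>))\<^sup>2 =
      (e + b)\<^sup>2 + e\<^sup>2 + 4 * (sqrt \<epsilon>)\<^sup>2 + (2 * (e * e) + 2 * (e * b) + 8 * (e * sqrt \<epsilon>) + 4 * (b * sqrt \<epsilon>))"
    by (simp add: power2_eq_square algebra_simps)
  ultimately show "s \<le> (2 * e + (b + 2 * sqrt \<epsilon>))\<^sup>2" using assms(1) by linarith
qed (use assms in auto)

lemma sqrt_sqrt_eq_powr: "0 \<le> x \<Longrightarrow> sqrt (sqrt x) = x powr (1/4)"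
  by (simp add: powr_half_sqrt[symmetric] powr_powr)

text \<open>The error beyond the operator error, in units of
  \<open>Cmax m / real n powr (1/4)\<close>: the 1 stands for the averaging remainder, the other
  summand for twice the square root of the concentration radius.\<close>

definition conf_term :: "nat \<Rightarrow> real \<Rightarrow> real" where
  "conf_term k \<delta> = 1 + 2 * (ln (4 * (real k)\<^sup>2 / \<delta>) / 2) powr (1/4)"

text \<open>The selection takes values in a discrete space, so every function of it is
  measurable.\<close>

lemma subopt_measurable:
  assumes "is_RM_FP m n M D XX H Xhat"
  shows "(\<lambda>\<omega>. subopt m \<pi> XX CC (Qbar m H (Xhat \<omega>))) \<in> borel_measurable M"
proof -
  have "Xhat \<in> M \<rightarrow>\<^sub>M count_space XX" using assms by (simp add: is_RM_FP_def)
  then show ?thesis by (rule measurable_compose) simp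
qed

section \<open>The bound with high probability\<close>

context offline_mdp
begin

lemma subopt_high_probability:
  fixes Xhat :: "'w \<Rightarrow> ('s \<times> 'a \<Rightarrow> real) \<Rightarrow> ('s \<times> 'a \<Rightarrow> real)"
  assumes D: "is_dataset m \<pi> \<mu> n M D" and n: "1 \<le> n" and H: "real n powr (1/4) \<le> real H"
    and XX: "finite XX" "XX \<noteq> {}" "XX \<subseteq> Omega m" and \<delta>: "0 < \<delta>" "\<delta> < 1"
    and link: "is_L2_link m \<pi> \<mu> \<phi>" and RM: "is_RM_FP m n M D XX H Xhat"
  shows "1 - \<delta> \<le> measure M {\<omega>\<in>space M. subopt m \<pi> XX (C2 m \<pi> \<mu> \<phi>) (Qbar m H (Xhat \<omega>))
    \<le> \<phi> (Cmax m * conf_term (card XX) \<delta> / real n powr (1/4))}" (is "_ \<le> measure M ?S")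
proof -
  interpret prob_space M using D by (simp add: is_dataset_def)
  have H1: "1 \<le> H"
    using H n ge_one_powr_ge_zero[of "real n" "1/4"] by simp
  define L where "L = ln (4 * (real (card XX))\<^sup>2 / \<delta>)"
  define \<epsilon> where "\<epsilon> = conc_radius (card XX) n \<delta>"
  have "1 \<le> (real (card XX))\<^sup>2" using XX(1,2) by (simp add: Suc_le_eq card_gt_0_iff)
  then have L: "0 \<le> L" using \<delta> by (simp add: L_def field_simps)
  have \<epsilon>: "0 \<le> \<epsilon>" using L by (simp add: \<epsilon>_def conc_radius_def L_def[symmetric])
  \<comment> \<open>The radius decays like a square root in n; the Bellman error takes its root once
    more, which produces the exponent 1/4.\<close>
  have "sqrt \<epsilon> = Cmax m * (L / (2 * real n)) powr (1/4)"
    using L n Cmax_ge_1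
    by (simp only: \<epsilon>_def conc_radius_def L_def[symmetric] real_sqrt_mult real_sqrt_abs
      sqrt_sqrt_eq_powr abs_of_nonneg divide_nonneg_nonneg mult_nonneg_nonneg of_nat_0_le_iff zero_le_numeral
      order_trans[OF zero_le_one Cmax_ge_1])
  also have "\<dots> = Cmax m * ((L / 2) powr (1/4) / real n powr (1/4))"
    using L n by (simp add: powr_divide[symmetric])
  finally have sq\<epsilon>: "sqrt \<epsilon> = Cmax m * ((L / 2) powr (1/4) / real n powr (1/4))" .
  \<comment> \<open>The growth condition on \<open>H\<close> brings the averaging remainder down to
    the same order in n as \<open>sqrt \<epsilon>\<close>.\<close>
  have CH: "Cmax m / real H \<le> Cmax m / real n powr (1/4)"
    using H n H1 Cmax_ge_1 by (intro divide_left_mono mult_pos_pos) auto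
  have t: "Cmax m / real H + 2 * sqrt \<epsilon> \<le> Cmax m * conf_term (card XX) \<delta> / real n powr (1/4)"
    unfolding sq\<epsilon> conf_term_def L_def[symmetric] using CH by (simp add: distrib_left add_divide_distrib mult_ac)
  have lk: "is_link \<phi>" using link by (simp add: is_L2_link_def)
  have "(MIN X\<in>XX. C2 m \<pi> \<mu> \<phi> X) \<in> C2 m \<pi> \<mu> \<phi> ` XX" using XX by (intro Min_in) auto
  then obtain Xs where Xs: "Xs \<in> XX" "(MIN X\<in>XX. C2 m \<pi> \<mu> \<phi> X) = C2 m \<pi> \<mu> \<phi> Xs" by blast
  define e where "e = enn2real (op_err m \<pi> \<mu> Xs)"
  obtain G where G: "G \<in> sets M" "1 - \<delta> \<le> measure M G" and conc:
    "\<And>\<omega> X A. \<omega> \<in> G \<Longrightarrow> X \<in> XX \<Longrightarrow> A \<in> insert id XX \<Longrightarrow>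
      \<bar>sq_loss (mdp_disc m) n (\<lambda>i. D i \<omega>) A (Qbar m H X) - risk (A (Qbar m H X)) (Qbar m H X)\<bar> \<le> \<epsilon>"
    unfolding \<epsilon>_def using uniform_concentration[OF D n H1 XX \<delta>] by blast
  have Xm: "Xhat \<in> M \<rightarrow>\<^sub>M count_space XX" using RM by (simp add: is_RM_FP_def)
  have sub: "G \<subseteq> ?S"
  proof
    fix \<omega> assume \<omega>: "\<omega> \<in> G"
    then have \<omega>M: "\<omega> \<in> space M" using G(1) sets.sets_into_space by blast
    define f where "f = Qbar m H (Xhat \<omega>)"
    have XO: "Xhat \<omega> \<in> Omega m" using measurable_space[OF Xm \<omega>M] XX(3) by auto
    have fQ: "f \<in> Qfuns m" unfolding f_def by (rule Qbar_Qfuns[OF XO H1])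
    have "sqerr f f \<le> (e + Cmax m / real H)\<^sup>2 + e\<^sup>2 + 4 * \<epsilon>"
      unfolding f_def e_def
    proof (rule selection_error[OF XX(1,3) H1 Xs(1) _ conc[OF \<omega>]])
      show "is_arg_min (\<lambda>X. fp_regret (mdp_disc m) n (\<lambda>i. D i \<omega>) (Qbar m H X) XX) (\<lambda>X. X \<in> XX) (Xhat \<omega>)"
        using RM \<omega>M by (simp add: is_RM_FP_def)
    qed
    then have "sqrt (sqerr f f) \<le> 2 * e + (Cmax m / real H + 2 * sqrt \<epsilon>)"
      using Cmax_ge_1 \<epsilon> by (intro sqrt_error_bound) (auto simp: e_def)
    also have "\<dots> \<le> 2 * e + Cmax m * conf_term (card XX) \<delta> / real n powr (1/4)" (is "_ \<le> _ + ?t")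
      using t by simp
    finally have le: "sqrt (sqerr f f) \<le> 2 * e + ?t" .
    have t0: "0 \<le> ?t" using Cmax_ge_1 \<epsilon> by (intro order_trans[OF _ t]) simp
    have e0: "0 \<le> e" by (simp add: e_def)
    have "\<bar>Delta_J m \<pi> f\<bar> \<le> \<phi> (enn2real (L2norm \<mu> (\<lambda>x. f x - Bellman m \<pi> f x)))"
      using link fQ unfolding is_L2_link_def by blast
    also have "\<dots> = \<phi> (sqrt (sqerr f f))"
      by (simp add: L2norm_eq_sqrt_sqerr[OF fQ fQ] sqerr_nonneg)
    also have "\<dots> \<le> \<phi> (2 * e + ?t)"
      by (rule is_link_mono[OF lk _ le]) (simp add: sqerr_nonneg)
    \<comment> \<open>Subadditivity splits off \<open>\<phi> ?t\<close> and then bounds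
      \<open>\<phi> (e + e)\<close> by two copies of \<open>\<phi> e\<close>; nonnegativity raises
      the factor to the 3 of \<open>C2\<close>.\<close>
    also have "\<dots> \<le> \<phi> (e + e) + \<phi> ?t"
      using is_link_subadditive[OF lk _ t0, of "2 * e"] e0 by simp
    also have "\<dots> \<le> 3 * \<phi> e + \<phi> ?t"
      using is_link_subadditive[OF lk e0 e0] is_link_nonneg[OF lk e0] by simp
    finally have "\<bar>Delta_J m \<pi> f\<bar> - (MIN X\<in>XX. C2 m \<pi> \<mu> \<phi> X) \<le> \<phi> ?t"
      unfolding Xs(2) by (simp add: C2_def e_def)
    moreover have "0 \<le> \<phi> ?t" by (rule is_link_nonneg[OF lk t0])
    ultimately show "\<omega> \<in> ?S" using \<omega>M by (simp add: subopt_def f_def)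
  qed
  have "(\<lambda>\<omega>. subopt m \<pi> XX (C2 m \<pi> \<mu> \<phi>) (Qbar m H (Xhat \<omega>))) \<in> borel_measurable M"
    by (rule subopt_measurable[OF RM])
  then have "?S \<in> sets M" by measurable
  then show ?thesis by (rule order_trans[OF G(2) finite_measure_mono[OF sub]])
qed

end

section \<open>Convergence in probability\<close>

text \<open>Uses continuity of the link at 0 rather than its linear bound, which says nothing for y
  > 0 if the weight has infinite norm.\<close>

lemma optimality:
  fixes H :: "nat \<Rightarrow> nat" and M :: "nat \<Rightarrow> 'w measure"
  assumes setting: "is_mdp m" "is_policy m \<pi>" "is_sampling m \<mu>" and link: "is_L2_link m \<pi> \<mu> \<phi>"
    and XX: "finite XX" "XX \<noteq> {}" "XX \<subseteq> Omega m"
    and data: "\<And>n. 1 \<le> n \<Longrightarrow> real n powr (1/4) \<le> real (H n) \<and> is_dataset m \<pi> \<mu> n (M n) (D n) \<and>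
      is_RM_FP m n (M n) (D n) XX (H n) (Xhat n)"
  shows "is_optimal m \<pi> XX (C2 m \<pi> \<mu> \<phi>) M (\<lambda>n \<omega>. Qbar m (H n) (Xhat n \<omega>))"
  unfolding is_optimal_def
proof (intro allI impI)
  interpret offline_mdp m \<pi> \<mu> by (rule offline_mdp.intro[OF setting])
  let ?s = "\<lambda>n \<omega>. subopt m \<pi> XX (C2 m \<pi> \<mu> \<phi>) (Qbar m (H n) (Xhat n \<omega>))"
  fix \<epsilon> :: real assume \<epsilon>: "0 < \<epsilon>"
  show "(\<lambda>n. measure (M n) {\<omega>\<in>space (M n). \<epsilon> < ?s n \<omega>}) \<longlonglongrightarrow> 0"
  proof (rule tendstoI)
    fix e :: real assume e: "0 < e"
    \<comment> \<open>A fixed confidence level below \<open>e\<close>: \<open>t n\<close> then tends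
      to 0, and the failure probability is at most \<open>\<delta>\<close> for all large n.\<close>
    define \<delta> where "\<delta> = min e 1 / 2"
    have \<delta>: "0 < \<delta>" "\<delta> < 1" "\<delta> < e" using e by (auto simp: \<delta>_def)
    define t where "t n = Cmax m * conf_term (card XX) \<delta> / real n powr (1/4)" for n :: nat
    have "0 \<le> conf_term (card XX) \<delta>" by (simp add: conf_term_def)
    then have t_nonneg: "0 \<le> t n" for n using Cmax_ge_1 by (simp add: t_def)
    have "t \<longlonglongrightarrow> 0"
    proof -
      have "(\<lambda>n. real n powr (- (1/4))) \<longlonglongrightarrow> 0"
        by (rule tendsto_neg_powr) (auto simp: filterlim_real_sequentially)
      from tendsto_mult_right_zero[OF this, of "Cmax m * conf_term (card XX) \<delta>"] show ?thesis
        by (simp add: t_def[abs_def] powr_minus_divide)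
    qed
    then have "(\<lambda>n. \<phi> (t n)) \<longlonglongrightarrow> \<phi> 0"
      using link t_nonneg
      by (intro continuous_on_tendsto_compose[of "{0..}" \<phi>]) (auto simp: is_L2_link_def is_link_def)
    then have "(\<lambda>n. \<phi> (t n)) \<longlonglongrightarrow> 0" using link by (simp add: is_L2_link_def is_link_def)
    then have "eventually (\<lambda>n. \<phi> (t n) < \<epsilon>) sequentially" using \<epsilon> by (rule order_tendstoD)
    moreover have "eventually (\<lambda>n::nat. 1 \<le> n) sequentially" by (rule eventually_ge_at_top)
    ultimately show "eventually (\<lambda>n. dist (measure (M n) {\<omega>\<in>space (M n). \<epsilon> < ?s n \<omega>}) 0 < e) sequentially"
    proof eventually_elim
      case (elim n)
      have RM: "is_RM_FP m n (M n) (D n) XX (H n) (Xhat n)"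
        and D: "is_dataset m \<pi> \<mu> n (M n) (D n)" and H: "real n powr (1/4) \<le> real (H n)"
        using data[OF elim(2)] by auto
      interpret prob_space "M n" using D by (simp add: is_dataset_def)
      note [measurable] = subopt_measurable[OF RM]
      have "1 - \<delta> \<le> measure (M n) {\<omega>\<in>space (M n). ?s n \<omega> \<le> \<phi> (t n)}"
        unfolding t_def by (rule subopt_high_probability[OF D elim(2) H XX \<delta>(1,2) link RM])
      also have "\<dots> \<le> measure (M n) {\<omega>\<in>space (M n). ?s n \<omega> \<le> \<epsilon>}"
        using elim(1) by (intro finite_measure_mono) auto
      also have "\<dots> = 1 - measure (M n) {\<omega>\<in>space (M n). \<epsilon> < ?s n \<omega>}"
        using prob_neg[of "\<lambda>\<omega>. \<epsilon> < ?s n \<omega>"] by (simp add: not_less)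
      finally show ?case using \<delta>(3) by simp
    qed
  qed
qed

section \<open>The explicit rate\<close>

text \<open>The lower bound \<open>l\<^sub>0\<close> on the logarithm lets the additive constants 1
  and ln 4 be absorbed into multiples of it.\<close>

lemma conf_term_le:
  assumes l0: "0 < l\<^sub>0" and l: "l\<^sub>0 \<le> ln (real k / \<delta>)" and k: "1 \<le> k" and \<delta>: "0 < \<delta>" "\<delta> < 1"
  shows "conf_term k \<delta> \<le> (1 / l\<^sub>0 powr (1/4) + 2 * (ln 4 / l\<^sub>0 + 2) powr (1/4)) * ln (real k / \<delta>) powr (1/4)"
proof -
  define l where "l = ln (real k / \<delta>)"
  have lpos: "0 < l" "l\<^sub>0 \<le> l" using l0 l by (auto simp: l_def)
  have "ln (4 * (real k)\<^sup>2 / \<delta>) = ln 4 + 2 * ln (real k) - ln \<delta>"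
    using k \<delta> by (simp add: ln_div ln_mult ln_realpow)
  \<comment> \<open>As \<delta> < 1, the term - ln \<delta> is nonnegative and may be
    doubled.\<close>
  also have "\<dots> \<le> ln 4 + 2 * (ln (real k) - ln \<delta>)" using \<delta> by simp
  also have "\<dots> = ln 4 + 2 * l" using k \<delta> by (simp add: l_def ln_div)
  also have "\<dots> \<le> (ln 4 / l\<^sub>0 + 2) * l"
  proof -
    have "l\<^sub>0 * ln 4 \<le> l * ln 4" using lpos by (intro mult_right_mono) auto
    then show ?thesis using l0 by (simp add: field_simps)
  qed
  finally have *: "ln (4 * (real k)\<^sup>2 / \<delta>) \<le> (ln 4 / l\<^sub>0 + 2) * l" .
  have "1 \<le> (real k)\<^sup>2" using k by simp
  then have "0 \<le> ln (4 * (real k)\<^sup>2 / \<delta>)" using \<delta> by (simp add: field_simps)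
  with * have "(ln (4 * (real k)\<^sup>2 / \<delta>) / 2) powr (1/4) \<le> ((ln 4 / l\<^sub>0 + 2) * l) powr (1/4)"
    by (intro powr_mono2) linarith+
  also have "\<dots> = (ln 4 / l\<^sub>0 + 2) powr (1/4) * l powr (1/4)"
    using lpos l0 by (simp add: powr_mult)
  finally have 1: "(ln (4 * (real k)\<^sup>2 / \<delta>) / 2) powr (1/4) \<le> (ln 4 / l\<^sub>0 + 2) powr (1/4) * l powr (1/4)" .
  have "l\<^sub>0 powr (1/4) \<le> l powr (1/4)" using lpos l0 by (intro powr_mono2) auto
  then have "1 \<le> 1 / l\<^sub>0 powr (1/4) * l powr (1/4)" using l0 by (simp add: field_simps)
  with 1 show ?thesis unfolding conf_term_def l_def[symmetric] by (simp add: distrib_right)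
qed

text \<open>One factor \<open>Cmax m\<close> comes from the linear bound on the link and one from
  its argument \<open>t\<close>. The estimate stays in the extended reals to allow an infinite
  weight norm.\<close>

lemma subopt_rate:
  fixes M :: "'w measure"
  assumes setting: "is_mdp m" "is_policy m \<pi>" "is_sampling m \<mu>" and link: "is_L2_link m \<pi> \<mu> \<phi>"
    and XX: "finite XX" "XX \<noteq> {}" "XX \<subseteq> Omega m"
    and n: "1 \<le> n" and H: "real n powr (1/4) \<le> real H" and D: "is_dataset m \<pi> \<mu> n M D"
    and RM: "is_RM_FP m n M D XX H Xhat" and \<delta>: "0 < \<delta>" "\<delta> < 1"
    and l0: "0 < l\<^sub>0" "l\<^sub>0 \<le> ln (real (card XX) / \<delta>)"
    and K: "K = 1 / l\<^sub>0 powr (1/4) + 2 * (ln 4 / l\<^sub>0 + 2) powr (1/4)"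
  shows "1 - \<delta> \<le> measure M {\<omega>\<in>space M.
    ennreal (subopt m \<pi> XX (C2 m \<pi> \<mu> \<phi>) (Qbar m H (Xhat \<omega>)))
      \<le> ennreal (K * (Cmax m)\<^sup>2) * L2norm \<mu> (weight m \<pi> \<mu>) *
        ennreal ((ln (real (card XX) / \<delta>) / real n) powr (1/4))}"
proof -
  interpret offline_mdp m \<pi> \<mu> by (rule offline_mdp.intro[OF setting])
  interpret prob_space M using D by (simp add: is_dataset_def)
  let ?s = "\<lambda>\<omega>. subopt m \<pi> XX (C2 m \<pi> \<mu> \<phi>) (Qbar m H (Xhat \<omega>))"
  let ?W = "L2norm \<mu> (weight m \<pi> \<mu>)"
  note [measurable] = subopt_measurable[OF RM]
  define t where "t = Cmax m * conf_term (card XX) \<delta> / real n powr (1/4)"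
  define r where "r = (ln (real (card XX) / \<delta>) / real n) powr (1/4)"
  have k: "1 \<le> card XX" using XX(1,2) by (simp add: Suc_le_eq card_gt_0_iff)
  have C0: "0 \<le> Cmax m" using Cmax_ge_1 by simp
  have K0: "0 \<le> K" using l0 by (simp add: K)
  have t0: "0 \<le> t" using C0 by (simp add: t_def conf_term_def)
  have "t \<le> Cmax m * (K * ln (real (card XX) / \<delta>) powr (1/4)) / real n powr (1/4)"
    unfolding t_def K using C0
    by (intro divide_right_mono mult_left_mono conf_term_le[OF l0 k \<delta>]) auto
  also have "\<dots> = Cmax m * K * r" using l0 by (simp add: r_def powr_divide)
  finally have t: "t \<le> Cmax m * K * r" .
  have "ennreal (\<phi> t) \<le> ennreal (Cmax m) * ?W * ennreal t"
    using link t0 by (simp add: is_L2_link_def)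
  also have "\<dots> \<le> ennreal (Cmax m) * ?W * ennreal (Cmax m * K * r)"
    using t by (intro mult_left_mono ennreal_leI) auto
  also have "\<dots> = ennreal (K * (Cmax m)\<^sup>2) * ?W * ennreal r"
    using C0 K0 by (simp add: ennreal_mult' power2_eq_square mult_ac r_def)
  finally have bound: "ennreal (\<phi> t) \<le> ennreal (K * (Cmax m)\<^sup>2) * ?W * ennreal r" .
  have "1 - \<delta> \<le> measure M {\<omega>\<in>space M. ?s \<omega> \<le> \<phi> t}"
    unfolding t_def by (rule subopt_high_probability[OF D n H XX \<delta> link RM])
  also have "\<dots> \<le> measure M {\<omega>\<in>space M. ennreal (?s \<omega>) \<le> ennreal (K * (Cmax m)\<^sup>2) * ?W * ennreal r}"
  proof (rule finite_measure_mono)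
    show "{\<omega>\<in>space M. ?s \<omega> \<le> \<phi> t} \<subseteq> {\<omega>\<in>space M. ennreal (?s \<omega>) \<le> ennreal (K * (Cmax m)\<^sup>2) * ?W * ennreal r}"
      using order_trans[OF ennreal_leI bound] by auto
  qed measurable
  finally show ?thesis by (simp only: r_def)
qed

text \<open>\<open>K\<close> is fixed before the process, the operators and the data: it is the
  universal constant behind the O-notation. For a single operator the logarithm tends to 0 as
  \<delta> approaches 1, and \<open>\<delta>\<^sub>0\<close> keeps it away from 0.\<close>

theorem proposition7:
  shows
  "(\<forall>(m :: ('s, 'a) mdp) \<pi> \<mu> \<phi> XX (H :: nat \<Rightarrow> nat) (M :: nat \<Rightarrow> 'w measure) D Xhat.
      is_mdp m \<and> is_policy m \<pi> \<and> is_sampling m \<mu> \<and>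
      (\<forall>h\<ge>1. absolutely_continuous \<mu> (visit_law m \<pi> h)) \<and> is_L2_link m \<pi> \<mu> \<phi> \<and>
      finite XX \<and> XX \<noteq> {} \<and> XX \<subseteq> Omega m \<and>
      (\<forall>n\<ge>1. real (H n) \<ge> real n powr (1/4) \<and> is_dataset m \<pi> \<mu> n (M n) (D n) \<and>
         is_RM_FP m n (M n) (D n) XX (H n) (Xhat n))
      \<longrightarrow> is_optimal m \<pi> XX (C2 m \<pi> \<mu> \<phi>) M (\<lambda>n \<omega>. Qbar m (H n) (Xhat n \<omega>)))
   \<and>
   (\<forall>\<delta>\<^sub>0::real. 0 < \<delta>\<^sub>0 \<and> \<delta>\<^sub>0 < 1 \<longrightarrow>
     (\<exists>K::real. K > 0 \<and>
       (\<forall>(m :: ('s, 'a) mdp) \<pi> \<mu> \<phi> XX (n::nat) (H::nat) (M :: 'w measure) D Xhat (\<delta>::real).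
          is_mdp m \<and> is_policy m \<pi> \<and> is_sampling m \<mu> \<and>
          (\<forall>h\<ge>1. absolutely_continuous \<mu> (visit_law m \<pi> h)) \<and> is_L2_link m \<pi> \<mu> \<phi> \<and>
          finite XX \<and> XX \<noteq> {} \<and> XX \<subseteq> Omega m \<and>
          n \<ge> 1 \<and> real H \<ge> real n powr (1/4) \<and> is_dataset m \<pi> \<mu> n M D \<and>
          is_RM_FP m n M D XX H Xhat \<and>
          0 < \<delta> \<and> \<delta> < 1 \<and> (card XX \<ge> 2 \<or> \<delta> \<le> \<delta>\<^sub>0)
          \<longrightarrow> measure M {\<omega> \<in> space M.
                ennreal (subopt m \<pi> XX (C2 m \<pi> \<mu> \<phi>) (Qbar m H (Xhat \<omega>)))
                \<le> ennreal (K * (Cmax m)\<^sup>2) * L2norm \<mu> (weight m \<pi> \<mu>) *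
                   ennreal ((ln (real (card XX) / \<delta>) / real n) powr (1/4))}
              \<ge> 1 - \<delta>)))"
proof (intro conjI allI impI, goal_cases)
  case (1 m \<pi> \<mu> \<phi> XX H M D Xhat)
  then show ?case by (intro optimality[where D=D and H=H]) blast+
next
  case (2 \<delta>\<^sub>0)
  \<comment> \<open>\<open>ln 2\<close> is the lower bound on the logarithm for at least two
    operators, \<open>ln (1 / \<delta>\<^sub>0)\<close> the one for \<delta> at most
    \<open>\<delta>\<^sub>0\<close>.\<close>
  define l\<^sub>0 where "l\<^sub>0 = min (ln 2) (ln (1 / \<delta>\<^sub>0))"
  define K where "K = 1 / l\<^sub>0 powr (1/4) + 2 * (ln 4 / l\<^sub>0 + 2) powr (1/4)"
  have l0: "0 < l\<^sub>0" using 2 by (simp add: l\<^sub>0_def)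
  then have K: "0 < K" by (simp add: K_def add_pos_nonneg)
  have l: "l\<^sub>0 \<le> ln (real k / \<delta>)" if \<delta>: "0 < \<delta>" "\<delta> < 1" "2 \<le> k \<or> \<delta> \<le> \<delta>\<^sub>0" and k: "1 \<le> k" for k \<delta>
    using \<delta>(3)
  proof
    assume "2 \<le> k"
    then have "2 \<le> real k / \<delta>" using \<delta> by (simp add: field_simps)
    then show ?thesis by (simp add: l\<^sub>0_def min.coboundedI1)
  next
    assume "\<delta> \<le> \<delta>\<^sub>0"
    then have "1 / \<delta>\<^sub>0 \<le> real k / \<delta>" using \<delta> k by (intro frac_le) auto
    moreover have "0 < 1 / \<delta>\<^sub>0" using 2 by simp
    ultimately have "ln (1 / \<delta>\<^sub>0) \<le> ln (real k / \<delta>)" by (intro ln_mono)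
    then show ?thesis by (simp add: l\<^sub>0_def min.coboundedI2)
  qed
  show ?case
  proof (intro exI[of _ K] conjI K allI impI, goal_cases)
    case (1 m \<pi> \<mu> \<phi> XX n H M D Xhat \<delta>)
    then have "1 \<le> card XX" by (simp add: Suc_le_eq card_gt_0_iff)
    with 1 have "l\<^sub>0 \<le> ln (real (card XX) / \<delta>)" by (intro l) blast+
    with 1 l0 K_def show ?case
      by (intro subopt_rate[where D=D and n=n and l\<^sub>0=l\<^sub>0]) blast+
  qed
qed

end
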